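(* Assume that there is a constant $C_B>0$ such that $\|\varphi\|_{H^1}\le C_B h^{-1}\|\varphi\|_{L^2}$ for all $h\in(0,1)$ and all $\varphi\in S_h$. Let $0<T<\infty$, $h\in(0,1)$ and $\psi_{0h}\in S_h$. Then, if the time discretization scale $\tau=T/N$ is sufficiently small (i.e. there is $\tau_0>0$, possibly depending on $h$, $\psi_{0h}$ and the other data, such that for all $N\in\mathbb{N}$ with $T/N\le\tau_0$), there exists a unique incoherent fully discrete solution $\Psi\in S_h^{\times(N+1)}$ of the Hartree initial-boundary value problem with initial condition $\psi_{0h}$.
   Context: Setting: $\Omega\subset\mathbb{R}^d$ is a bounded domain with smooth boundary; $v\in C_0^\infty(\Omega,\mathbb{R})$, $\lambda\in C_0^\infty(\Omega,\mathbb{R})$, $V\in C_0^\infty(\mathbb{R}^d,\mathbb{R})$, where the subscript $0$ denotes compact support. All Lebesgue and Sobolev spaces are spaces of complex-valued functions over $\Omega$; $(\cdot,\cdot)_{L^2}$ is the $L^2$ scalar product, antilinear in the first and linear in the second argument. Define $g_V[\varphi](x):=\int_\Omega V(x-y)\varphi(y)\,dy$. Galerkin spaces: $\{S_h\}_{h\in(0,1)}$ is a family of (complex) linear subspaces of $H^1_0$ with $S_h\subset C(\overline\Omega)\cap H_0^1$ and $\dim S_h=N_h<\infty$ for all $h\in(0,1)$. Time discretization: for $0<T<\infty$ and $N\in\mathbb{N}$, $N\ge1$, put $\tau:=T/N$. For $\Psi=(\Psi_0,\dots,\Psi_N)\in S_h^{\times(N+1)}$ and $n\in\{1,\dots,N\}$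 put $\Psi_{n-1/2}:=\frac12(\Psi_n+\Psi_{n-1})$ and $\dot\Psi_n:=\frac1\tau(\Psi_n-\Psi_{n-1})$. $\Psi\in S_h^{\times(N+1)}$ is an incoherent fully discrete solution with initial condition $\psi_{0h}\in S_h$ if $\Psi_0=\psi_{0h}$ and $$i(\varphi,\dot\Psi_n)_{L^2}=(\nabla\varphi,\nabla\Psi_{n-1/2})_{L^2}+(\varphi,v\Psi_{n-1/2})_{L^2}+\big(\varphi,\tfrac12\lambda\, g_V[|\Psi_n|^2+|\Psi_{n-1}|^2]\,\Psi_{n-1/2}\big)_{L^2}$$ for all $\varphi\in S_h$ and $n\in\{1,\dots,N\}$. *)

theory Defs
  imports "HOL-Analysis.Analysis" "HOL-Library.Function_Algebras"
begin

subsection \<open>Smooth functions and smooth domains\<close>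

text \<open>Partial derivative in direction \<open>i\<close> (for \<open>i \<in> Basis\<close>), meaningful where \<open>f\<close> is differentiable.\<close>

definition partial_deriv ::
    "'a::euclidean_space \<Rightarrow> ('a \<Rightarrow> 'b::real_normed_vector) \<Rightarrow> 'a \<Rightarrow> 'b" where
  "partial_deriv i f x = frechet_derivative f (at x) i"

text \<open>\<open>C_on k U f\<close>: \<open>f\<close> is of class $C^k$ on \<open>U\<close>. Only to be used for open \<open>U\<close>.\<close>

primrec C_on ::
    "nat \<Rightarrow> 'a::euclidean_space set \<Rightarrow> ('a \<Rightarrow> 'b::real_normed_vector) \<Rightarrow> bool" where
  "C_on 0 U f \<longleftrightarrow> continuous_on U f"
| "C_on (Suc k) U f \<longleftrightarrow>
     (\<forall>x\<in>U. f differentiable (at x)) \<and> (\<forall>i\<in>Basis. C_on k U (partial_deriv i f))"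

definition smooth_on ::
    "'a::euclidean_space set \<Rightarrow> ('a \<Rightarrow> 'b::real_normed_vector) \<Rightarrow> bool" where
  "smooth_on U f \<longleftrightarrow> (\<forall>k. C_on k U f)"

text \<open>$C_0^\infty(\Omega)$, each element being identified with its extension by zero to the
  whole space.\<close>

definition test_functions ::
    "'a::euclidean_space set \<Rightarrow> ('a \<Rightarrow> 'b::real_normed_vector) set" where
  "test_functions \<Omega> =
     {f. smooth_on UNIV f \<and> compact (closure {x. f x \<noteq> 0}) \<and> closure {x. f x \<noteq> 0} \<subseteq> \<Omega>}"

text \<open>Locally, and up to relabelling and reorienting the coordinate axes, \<open>\<Omega>\<close> is the region
  above the graph of a smooth function of the remaining coordinates;
  \<open>x - (x \<bullet> i) *\<^sub>R i\<close> is \<open>x\<close> with its \<open>i\<close>-th coordinate removed.\<close>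

definition smooth_boundary :: "'a::euclidean_space set \<Rightarrow> bool" where
  "smooth_boundary \<Omega> \<longleftrightarrow>
     (\<forall>p\<in>frontier \<Omega>. \<exists>r>0. \<exists>i\<in>Basis. \<exists>s\<in>{1, -1::real}. \<exists>\<gamma>::'a \<Rightarrow> real.
        smooth_on UNIV \<gamma> \<and>
        \<Omega> \<inter> ball p r = {x \<in> ball p r. \<gamma> (x - (x \<bullet> i) *\<^sub>R i) < s * (x \<bullet> i)})"

definition bounded_smooth_domain :: "'a::euclidean_space set \<Rightarrow> bool" where
  "bounded_smooth_domain \<Omega> \<longleftrightarrow>
     open \<Omega> \<and> connected \<Omega> \<and> \<Omega> \<noteq> {} \<and> bounded \<Omega> \<and> smooth_boundary \<Omega>"

subsection \<open>Lebesgue and Sobolev spaces of complex-valued functions\<close>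

text \<open>Elements of $L^2$ and $H^1$ are represented by functions; these sets are invariant under
  changes on null sets and outside \<open>\<Omega>\<close>.\<close>

definition L2 :: "'a::euclidean_space set \<Rightarrow> ('a \<Rightarrow> complex) set" where
  "L2 \<Omega> = {f \<in> borel_measurable (lebesgue_on \<Omega>).
             integrable (lebesgue_on \<Omega>) (\<lambda>x. (cmod (f x))\<^sup>2)}"

definition L2_inner ::
    "'a::euclidean_space set \<Rightarrow> ('a \<Rightarrow> complex) \<Rightarrow> ('a \<Rightarrow> complex) \<Rightarrow> complex" where
  "L2_inner \<Omega> f g = (LINT x|lebesgue_on \<Omega>. cnj (f x) * g x)"

definition L2_norm :: "'a::euclidean_space set \<Rightarrow> ('a \<Rightarrow> complex) \<Rightarrow> real" where
  "L2_norm \<Omega> f = sqrt (LINT x|lebesgue_on \<Omega>. (cmod (f x))\<^sup>2)"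

definition is_weak_partial ::
    "'a::euclidean_space set \<Rightarrow> 'a \<Rightarrow> ('a \<Rightarrow> complex) \<Rightarrow> ('a \<Rightarrow> complex) \<Rightarrow> bool" where
  "is_weak_partial \<Omega> i f g \<longleftrightarrow>
     (\<forall>\<phi> \<in> (test_functions \<Omega> :: ('a \<Rightarrow> complex) set).
        (LINT x|lebesgue_on \<Omega>. f x * partial_deriv i \<phi> x)
          = - (LINT x|lebesgue_on \<Omega>. g x * \<phi> x))"

definition H1 :: "'a::euclidean_space set \<Rightarrow> ('a \<Rightarrow> complex) set" where
  "H1 \<Omega> = {f \<in> L2 \<Omega>. \<forall>i\<in>Basis. \<exists>g \<in> L2 \<Omega>. is_weak_partial \<Omega> i f g}"

text \<open>A representative of the weak partial derivative, which is unique up to null sets.\<close>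

definition weak_partial ::
    "'a::euclidean_space set \<Rightarrow> 'a \<Rightarrow> ('a \<Rightarrow> complex) \<Rightarrow> 'a \<Rightarrow> complex" where
  "weak_partial \<Omega> i f = (SOME g. g \<in> L2 \<Omega> \<and> is_weak_partial \<Omega> i f g)"

definition grad_inner ::
    "'a::euclidean_space set \<Rightarrow> ('a \<Rightarrow> complex) \<Rightarrow> ('a \<Rightarrow> complex) \<Rightarrow> complex" where
  "grad_inner \<Omega> f g = (\<Sum>i\<in>Basis. L2_inner \<Omega> (weak_partial \<Omega> i f) (weak_partial \<Omega> i g))"

definition H1_norm :: "'a::euclidean_space set \<Rightarrow> ('a \<Rightarrow> complex) \<Rightarrow> real" where
  "H1_norm \<Omega> f = sqrt ((L2_norm \<Omega> f)\<^sup>2 + (\<Sum>i\<in>Basis. (L2_norm \<Omega> (weak_partial \<Omega> i f))\<^sup>2))"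

text \<open>$H^1_0$ is the closure of $C_0^\infty(\Omega)$ in $H^1$.\<close>

definition H10 :: "'a::euclidean_space set \<Rightarrow> ('a \<Rightarrow> complex) set" where
  "H10 \<Omega> = {f \<in> H1 \<Omega>. \<exists>\<phi>::nat \<Rightarrow> 'a \<Rightarrow> complex.
     (\<forall>n. \<phi> n \<in> test_functions \<Omega>) \<and> (\<lambda>n. H1_norm \<Omega> (\<lambda>x. f x - \<phi> n x)) \<longlonglongrightarrow> 0}"

text \<open>$C(\overline\Omega)$. The value \<open>0\<close> outside \<open>closure \<Omega>\<close> is a normalisation that makes the
  representing total function unique; nothing is required on the boundary except continuity
  from within \<open>closure \<Omega>\<close>.\<close>

definition C_closure :: "'a::euclidean_space set \<Rightarrow> ('a \<Rightarrow> complex) set" where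
  "C_closure \<Omega> = {f. continuous_on (closure \<Omega>) f \<and> (\<forall>x. x \<notin> closure \<Omega> \<longrightarrow> f x = 0)}"

subsection \<open>Galerkin spaces\<close>

global_interpretation cfun: vector_space "\<lambda>(c::complex) (f::'a \<Rightarrow> complex) x. c * f x"
  by unfold_locales (auto simp: fun_eq_iff algebra_simps)

text \<open>The explicit finite basis is needed because \<open>cfun.dim\<close> is \<open>0\<close> for infinite-dimensional
  spaces.\<close>

definition has_dim :: "('a \<Rightarrow> complex) set \<Rightarrow> nat \<Rightarrow> bool" where
  "has_dim S n \<longleftrightarrow>
     (\<exists>B. finite B \<and> card B = n \<and> cfun.independent B \<and> cfun.span B = S)"

definition galerkin_family ::
    "'a::euclidean_space set \<Rightarrow> (real \<Rightarrow> ('a \<Rightarrow> complex) set) \<Rightarrow> (real \<Rightarrow> nat) \<Rightarrow> bool" where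
  "galerkin_family \<Omega> S dims \<longleftrightarrow>
     (\<forall>h\<in>{0<..<1}. cfun.subspace (S h) \<and> S h \<subseteq> C_closure \<Omega> \<inter> H10 \<Omega> \<and> has_dim (S h) (dims h))"

subsection \<open>The fully discrete Hartree equation\<close>

definition hartree_g ::
    "'a::euclidean_space set \<Rightarrow> ('a \<Rightarrow> real) \<Rightarrow> ('a \<Rightarrow> complex) \<Rightarrow> 'a \<Rightarrow> complex" where
  "hartree_g \<Omega> V \<phi> x = (LINT y|lebesgue_on \<Omega>. complex_of_real (V (x - y)) * \<phi> y)"

text \<open>\<open>\<Psi>\<^bsub>n-1/2\<^esub>\<close> and the backward difference quotient, for \<open>n \<ge> 1\<close>.\<close>

definition midpt :: "(nat \<Rightarrow> 'a \<Rightarrow> complex) \<Rightarrow> nat \<Rightarrow> 'a \<Rightarrow> complex" where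
  "midpt \<Psi> n x = (\<Psi> n x + \<Psi> (n - 1) x) / 2"

definition time_diff :: "real \<Rightarrow> (nat \<Rightarrow> 'a \<Rightarrow> complex) \<Rightarrow> nat \<Rightarrow> 'a \<Rightarrow> complex" where
  "time_diff \<tau> \<Psi> n x = (\<Psi> n x - \<Psi> (n - 1) x) / complex_of_real \<tau>"

definition incoherent_solution ::
    "'a::euclidean_space set \<Rightarrow> ('a \<Rightarrow> real) \<Rightarrow> ('a \<Rightarrow> real) \<Rightarrow> ('a \<Rightarrow> real) \<Rightarrow>
     ('a \<Rightarrow> complex) set \<Rightarrow> real \<Rightarrow> nat \<Rightarrow> ('a \<Rightarrow> complex) \<Rightarrow> (nat \<Rightarrow> 'a \<Rightarrow> complex) \<Rightarrow> bool" where
  "incoherent_solution \<Omega> v lam V Sh T N \<psi>\<^sub>0 \<Psi> \<longleftrightarrow>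
     \<Psi> \<in> {0..N} \<rightarrow>\<^sub>E Sh \<and> \<Psi> 0 = \<psi>\<^sub>0 \<and>
     (\<forall>\<phi>\<in>Sh. \<forall>n\<in>{1..N}.
        \<i> * L2_inner \<Omega> \<phi> (time_diff (T / real N) \<Psi> n) =
          grad_inner \<Omega> \<phi> (midpt \<Psi> n)
          + L2_inner \<Omega> \<phi> (\<lambda>x. complex_of_real (v x) * midpt \<Psi> n x)
          + L2_inner \<Omega> \<phi> (\<lambda>x. 1/2 * complex_of_real (lam x)
              * hartree_g \<Omega> V
                  (\<lambda>y. complex_of_real ((cmod (\<Psi> n y))\<^sup>2 + (cmod (\<Psi> (n - 1) y))\<^sup>2)) x
              * midpt \<Psi> n x))"

end

theory Submission
  imports Defs
begin

text \<open>
  One time step asks for \<open>b \<in> S\<^sub>h\<close> with \<open>b = a - \<i> \<tau> F(a, b)\<close>, where \<open>F(a, b)\<close> represents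
  the right-hand side of the weak equation in the inner product of \<open>L\<^sup>2\<close>. As \<open>S\<^sub>h\<close> has finite
  dimension, \<open>F\<close> is bounded and Lipschitz in \<open>b\<close> on every ball: linear functionals are
  automatically bounded (\<open>linear_functional_bounded\<close>), and the cubic Hartree term can be
  estimated pointwise, since the \<open>L\<^sup>2\<close> norm controls the supremum norm
  (\<open>hartree_form_Lipschitz\<close>). For small \<open>\<tau>\<close>, Banach's fixed-point theorem gives exactly one
  solution in a ball somewhat larger than the norm of \<open>a\<close>.

  Two further points are settled at once by conservation of mass. Testing with the midpoint
  \<open>(a + b) / 2\<close> makes the right-hand side real, because the Laplacian is symmetric and \<open>v\<close> and
  the Hartree potential are real; hence \<open>b\<close> has the same norm as \<open>a\<close>
  (\<open>step_conserves_nrm\<close>). So every solution of the step lies in the ball where the map contracts,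
  which makes uniqueness global, and the admissible size of \<open>\<tau>\<close>, which depends on \<open>a\<close> only through
  its norm, is the same at all time levels (\<open>step_uniquely_solvable\<close>). Iterating the step gives
  the trajectory (\<open>unique_iteration\<close>).

  The remaining work lies in the function spaces. The form \<open>grad_inner\<close> is built from chosen
  representatives of weak derivatives, and its sesquilinearity (\<open>grad_inner_combine\<close>) rests on
  their uniqueness almost everywhere. That is the fundamental lemma of the calculus of
  variations, proved here with explicit smooth approximations of indicators of boxes and Lebesgue
  differentiation. The inner product of \<open>L\<^sup>2\<close> is definite on \<open>S\<^sub>h\<close> itself, not only up to null
  sets, because its elements are continuous up to the boundary and normalised outside
  (\<open>L2_norm_pos\<close>).
\<close>

section \<open>Finite-dimensional complex inner product spaces\<close>

text \<open>The Galerkin space is a subspace of a function space, not a type, so the inner product is only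
assumed to behave well on a carrier \<open>X\<close>, spanned by the finite set \<open>B\<close>.\<close>

locale finite_dim_inner_space = vector_space scale
  for scale :: "complex \<Rightarrow> 'v::ab_group_add \<Rightarrow> 'v" (infixr \<open>\<odot>\<close> 75) +
  fixes B X :: "'v set" and ip :: "'v \<Rightarrow> 'v \<Rightarrow> complex"
  assumes finite_B: "finite B" and span_B: "span B = X"
    and ip_add: "\<lbrakk>x \<in> X; y \<in> X; z \<in> X\<rbrakk> \<Longrightarrow> ip x (y + z) = ip x y + ip x z"
    and ip_scale: "\<lbrakk>x \<in> X; y \<in> X\<rbrakk> \<Longrightarrow> ip x (c \<odot> y) = c * ip x y"
    and ip_cnj: "\<lbrakk>x \<in> X; y \<in> X\<rbrakk> \<Longrightarrow> ip y x = cnj (ip x y)"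
    and ip_pos: "\<lbrakk>x \<in> X; x \<noteq> 0\<rbrakk> \<Longrightarrow> 0 < Re (ip x x)"
begin

lemma subspace_X: "subspace X"
  using span_B subspace_span by blast

lemmas X_closed [simp] =
  subspace_0[OF subspace_X] subspace_add[OF subspace_X] subspace_diff[OF subspace_X]
  subspace_scale[OF subspace_X] subspace_sum[OF subspace_X]

lemma ip_zero [simp]: "x \<in> X \<Longrightarrow> ip x 0 = 0"
  using ip_scale[of x 0 0] by simp

lemma ip_diff: "\<lbrakk>x \<in> X; y \<in> X; z \<in> X\<rbrakk> \<Longrightarrow> ip x (y - z) = ip x y - ip x z"
  using ip_add[of x "y - z" z] by simp

lemma ip_sum: "\<lbrakk>x \<in> X; \<And>i. i \<in> A \<Longrightarrow> f i \<in> X\<rbrakk> \<Longrightarrow> ip x (sum f A) = (\<Sum>i\<in>A. ip x (f i))"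
  by (induction A rule: infinite_finite_induct) (auto simp: ip_add)

lemma ip_add_left: "\<lbrakk>x \<in> X; y \<in> X; z \<in> X\<rbrakk> \<Longrightarrow> ip (y + z) x = ip y x + ip z x"
  using ip_cnj[of x "y + z"] ip_cnj[of x y] ip_cnj[of x z] by (simp add: ip_add)

lemma ip_scale_left: "\<lbrakk>x \<in> X; y \<in> X\<rbrakk> \<Longrightarrow> ip (c \<odot> y) x = cnj c * ip y x"
  using ip_cnj[of x "c \<odot> y"] ip_cnj[of x y] by (simp add: ip_scale)

lemma ip_self: "x \<in> X \<Longrightarrow> ip x x = complex_of_real (Re (ip x x))"
  using ip_cnj[of x x] by (simp add: complex_eq_iff)

definition orthonormal :: "'v set \<Rightarrow> bool" where
  "orthonormal E \<longleftrightarrow> (\<forall>e\<in>E. \<forall>f\<in>E. ip e f = (if e = f then 1 else 0))"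

lemma orthonormal_residual:
  assumes "finite E" "E \<subseteq> X" "orthonormal E" "x \<in> X" "e \<in> E"
  shows "ip e (x - (\<Sum>f\<in>E. ip f x \<odot> f)) = 0"
proof -
  have "ip e (\<Sum>f\<in>E. ip f x \<odot> f) = (\<Sum>f\<in>E. ip f x * ip e f)"
    using assms by (subst ip_sum) (auto intro!: sum.cong simp: ip_scale subset_iff)
  also have "\<dots> = (\<Sum>f\<in>E. if f = e then ip e x else 0)"
    using assms by (intro sum.cong) (auto simp: orthonormal_def)
  finally show ?thesis
    using assms by (subst ip_diff) (auto simp: subset_iff)
qed

text \<open>Gram-Schmidt, adding one vector \<open>b\<close> at a time: the residual of \<open>b\<close> after projection onto the
span so far is either zero, and then \<open>b\<close> contributes nothing, or it can be normalised and added.\<close>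

lemma gram_schmidt:
  assumes "finite C" "C \<subseteq> X"
  shows "\<exists>E. finite E \<and> span E = span C \<and> orthonormal E"
  using assms
proof (induction C)
  case empty
  then show ?case by (intro exI[of _ "{}"]) (simp add: orthonormal_def)
next
  case (insert b C)
  then obtain E where E: "finite E" "span E = span C" "orthonormal E" by auto
  have EX: "E \<subseteq> X"
    using E(2) insert.prems span_superset[of E] span_minimal[OF _ subspace_X, of C] by auto
  define p where "p = (\<Sum>f\<in>E. ip f b \<odot> f)"
  have p: "p \<in> span E" unfolding p_def by (intro span_sum span_scale span_base)
  define r where "r = b - p"
  have bX: "b \<in> X" and rX: "r \<in> X"
    using insert.prems EX unfolding r_def p_def by (auto intro!: X_closed simp: subset_iff)
  have orth: "ip e r = 0" if "e \<in> E" for e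
    unfolding r_def p_def by (rule orthonormal_residual[OF E(1) EX E(3) bX that])
  have "b - r \<in> span E" using p by (simp add: r_def)
  then have span_r: "span (insert r E) = span (insert b E)"
    using eq_span_insert_eq by metis
  have span_b: "span (insert b E) = span (insert b C)"
    using E(2) by (auto simp: span_insert)
  show ?case
  proof (cases "r = 0")
    case True
    then have "span E = span (insert b C)"
      using span_r span_b by simp
    then show ?thesis using E by auto
  next
    case False
    define c where "c = complex_of_real (1 / sqrt (Re (ip r r)))"
    have pos: "Re (ip r r) > 0" using ip_pos[OF rX False] .
    have c0: "c \<noteq> 0" using pos by (simp add: c_def)
    define u where "u = c \<odot> r"
    have uX: "u \<in> X" using rX by (simp add: u_def)
    have "u \<in> span (insert r E)" unfolding u_def by (intro span_scale span_base) simp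
    moreover have "r \<in> span (insert u E)"
    proof -
      have "r = (1 / c) \<odot> u" using c0 by (simp add: u_def)
      then show ?thesis by (metis insertI1 span_base span_scale)
    qed
    ultimately have "span (insert u E) = span (insert r E)"
      unfolding span_eq using span_superset[of "insert r E"] span_superset[of "insert u E"] by auto
    then have sp: "span (insert u E) = span (insert b C)" using span_r span_b by simp
    have eu: "ip e u = 0" if "e \<in> E" for e
      using orth[OF that] that EX rX by (auto simp: u_def ip_scale subset_iff)
    have ue: "ip u e = 0" if "e \<in> E" for e
      using eu[OF that] that EX uX ip_cnj[of e u] by (auto simp: subset_iff)
    have "ip u u = c * cnj c * complex_of_real (Re (ip r r))"
      using rX ip_self[OF rX] by (simp add: u_def ip_scale ip_scale_left)
    also have "\<dots> = complex_of_real ((1 / sqrt (Re (ip r r)))\<^sup>2 * Re (ip r r))"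
      unfolding c_def complex_cnj_complex_of_real power2_eq_square by (simp only: of_real_mult)
    also have "(1 / sqrt (Re (ip r r)))\<^sup>2 * Re (ip r r) = 1"
      using pos by (simp add: power_divide)
    finally have uu: "ip u u = 1" by simp
    have "u \<notin> E" using uu eu by force
    have "orthonormal (insert u E)"
      unfolding orthonormal_def
    proof (intro ballI)
      fix e f assume ef: "e \<in> insert u E" "f \<in> insert u E"
      consider "e = u" "f = u" | "e = u" "f \<in> E" | "e \<in> E" "f = u" | "e \<in> E" "f \<in> E"
        using ef by blast
      then show "ip e f = (if e = f then 1 else 0)"
      proof cases
        case 4 then show ?thesis using E(3) unfolding orthonormal_def by blast
      qed (use uu eu ue \<open>u \<notin> E\<close> in auto)
    qed
    then show ?thesis using sp E(1) by (intro exI[of _ "insert u E"]) simp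
  qed
qed

definition onb :: "'v set" where
  "onb = (SOME E. finite E \<and> span E = X \<and> orthonormal E)"

lemma onb: "finite onb" "span onb = X" "orthonormal onb"
proof -
  have "\<exists>E. finite E \<and> span E = X \<and> orthonormal E"
    using gram_schmidt[OF finite_B] span_B span_superset[of B] by auto
  from someI_ex[OF this, folded onb_def]
  show "finite onb" "span onb = X" "orthonormal onb" by blast+
qed

lemma onb_in_X [simp]: "e \<in> onb \<Longrightarrow> e \<in> X"
  using span_base[of e onb] onb(2) by simp

lemma onb_expansion:
  assumes "x \<in> X" shows "x = (\<Sum>e\<in>onb. ip e x \<odot> e)"
proof -
  define y where "y = x - (\<Sum>e\<in>onb. ip e x \<odot> e)"
  have yX: "y \<in> X" using assms by (simp add: y_def)
  have orth: "ip e y = 0" if "e \<in> onb" for e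
    unfolding y_def
    by (rule orthonormal_residual[OF onb(1) _ onb(3) assms that]) (simp add: subsetI)
  have "z \<in> X \<and> ip z y = 0" if "z \<in> span onb" for z
    using that
  proof (induction rule: span_induct_alt)
    case base
    then show ?case using ip_cnj[of y 0] yX by simp
  next
    case (step c e z)
    then show ?case using orth yX by (simp add: ip_add_left ip_scale_left)
  qed
  then have "ip y y = 0" using yX onb(2) by simp
  then have "y = 0" using ip_pos[OF yX] by force
  then show ?thesis by (simp add: y_def)
qed

definition nrm :: "'v \<Rightarrow> real" where "nrm x = sqrt (Re (ip x x))"

text \<open>Parseval's identity. It transfers the triangle inequality, and with it all the metric structure,
from the Euclidean norm of the coefficient vector to \<open>nrm\<close>.\<close>

lemma nrm_eq_L2_set:
  assumes "x \<in> X" shows "nrm x = L2_set (\<lambda>e. cmod (ip e x)) onb"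
proof -
  have "ip x x = ip x (\<Sum>e\<in>onb. ip e x \<odot> e)" by (rule arg_cong[OF onb_expansion[OF assms]])
  also have "\<dots> = (\<Sum>e\<in>onb. ip e x * ip x e)"
    using assms by (subst ip_sum) (auto simp: ip_scale)
  also have "\<dots> = (\<Sum>e\<in>onb. complex_of_real ((cmod (ip e x))\<^sup>2))"
  proof (intro sum.cong refl)
    fix e assume "e \<in> onb"
    then have "ip x e = cnj (ip e x)" by (intro ip_cnj assms onb_in_X)
    then show "ip e x * ip x e = complex_of_real ((cmod (ip e x))\<^sup>2)"
      by (simp only: complex_norm_square)
  qed
  finally have "ip x x = (\<Sum>e\<in>onb. complex_of_real ((cmod (ip e x))\<^sup>2))" .
  then show ?thesis by (simp add: nrm_def L2_set_def)
qed

lemma cmod_coeff_le: "\<lbrakk>x \<in> X; e \<in> onb\<rbrakk> \<Longrightarrow> cmod (ip e x) \<le> nrm x"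
  using member_le_L2_set[OF onb(1), of e "\<lambda>e. cmod (ip e x)"] by (simp add: nrm_eq_L2_set)

lemma nrm_le_sum: "x \<in> X \<Longrightarrow> nrm x \<le> (\<Sum>e\<in>onb. cmod (ip e x))"
  by (simp add: nrm_eq_L2_set L2_set_le_sum)

lemma nrm_nonneg [simp]: "x \<in> X \<Longrightarrow> 0 \<le> nrm x"
  by (simp add: nrm_eq_L2_set)

lemma nrm_eq_0_iff: "x \<in> X \<Longrightarrow> nrm x = 0 \<longleftrightarrow> x = 0"
  using ip_pos[of x] by (cases "x = 0") (auto simp: nrm_def)

lemma nrm_triangle:
  assumes "x \<in> X" "y \<in> X" shows "nrm (x + y) \<le> nrm x + nrm y"
proof -
  have "L2_set (\<lambda>e. cmod (ip e (x + y))) onb \<le> L2_set (\<lambda>e. cmod (ip e x) + cmod (ip e y)) onb"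
    using assms by (intro L2_set_mono) (auto simp: ip_add norm_triangle_ineq)
  also have "\<dots> \<le> L2_set (\<lambda>e. cmod (ip e x)) onb + L2_set (\<lambda>e. cmod (ip e y)) onb"
    by (rule L2_set_triangle_ineq)
  finally show ?thesis using assms by (simp add: nrm_eq_L2_set)
qed

lemma nrm_scale: "x \<in> X \<Longrightarrow> nrm (c \<odot> x) = cmod c * nrm x"
  by (simp add: nrm_eq_L2_set ip_scale norm_mult L2_set_right_distrib cong: L2_set_cong_simp)

lemma nrm_minus_commute: "\<lbrakk>x \<in> X; y \<in> X\<rbrakk> \<Longrightarrow> nrm (x - y) = nrm (y - x)"
  by (simp add: nrm_eq_L2_set ip_diff norm_minus_commute cong: L2_set_cong_simp)

lemma nrm_add_diff_le: "\<lbrakk>x \<in> X; y \<in> X; z \<in> X\<rbrakk> \<Longrightarrow> nrm (x - z) \<le> nrm (x - y) + nrm (y - z)"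
  using nrm_triangle[of "x - y" "y - z"] by simp

text \<open>The locale of abstract metric spaces asks for symmetry and nonnegativity at all arguments of the
type, hence the value \<open>0\<close> outside the carrier.\<close>

definition ball_dist :: "'v \<Rightarrow> 'v \<Rightarrow> real" where
  "ball_dist x y = (if x \<in> X \<and> y \<in> X then nrm (x - y) else 0)"

text \<open>In finite dimension continuity is free. Applied to the weak form of the Laplacian, this plays the
role of an inverse inequality with a constant that depends on the space.\<close>

lemma linear_functional_bounded:
  assumes L: "\<And>c x y. \<lbrakk>x \<in> X; y \<in> X\<rbrakk> \<Longrightarrow> L (c \<odot> x + y) = c * L x + L y"
  shows "\<exists>K. \<forall>x\<in>X. cmod (L x) \<le> K * nrm x"
proof (intro exI ballI)
  fix x assume x: "x \<in> X"
  have L0: "L 0 = 0" using L[of 0 0 1] by simp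
  have sum: "L (\<Sum>e\<in>F. c e \<odot> e) = (\<Sum>e\<in>F. c e * L e)" if "finite F" "F \<subseteq> onb" for c F
    using that by (induction F) (auto simp: L0 L subset_iff)
  have "L x = (\<Sum>e\<in>onb. ip e x * L e)"
    using arg_cong[OF onb_expansion[OF x], of L] sum[OF onb(1)] by simp
  also have "cmod \<dots> \<le> (\<Sum>e\<in>onb. cmod (L e) * nrm x)"
    by (intro sum_norm_le)
      (simp add: norm_mult mult.commute[of "cmod (ip _ x)"] mult_left_mono cmod_coeff_le x)
  finally show "cmod (L x) \<le> (\<Sum>e\<in>onb. cmod (L e)) * nrm x" by (simp add: sum_distrib_right)
qed

lemma Metric_space_ball: "Metric_space {x \<in> X. nrm x \<le> r} ball_dist"
  by unfold_locales
    (auto simp: ball_dist_def nrm_eq_0_iff nrm_minus_commute intro: nrm_add_diff_le)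

text \<open>Each coefficient of a Cauchy sequence is a Cauchy sequence of complex numbers; the limits of the
coefficients are the coefficients of the limit.\<close>

lemma mcomplete_ball: "Metric_space.mcomplete {x \<in> X. nrm x \<le> r} ball_dist"
proof -
  interpret Metric_space "{x \<in> X. nrm x \<le> r}" ball_dist by (rule Metric_space_ball)
  show ?thesis
    unfolding mcomplete_def
  proof (intro allI impI)
    fix \<sigma> assume \<sigma>: "MCauchy \<sigma>"
    have \<sigma>X: "\<sigma> n \<in> X" and \<sigma>r: "nrm (\<sigma> n) \<le> r" for n
      using \<sigma> by (auto simp: MCauchy_def)
    have "Cauchy (\<lambda>n. ip e (\<sigma> n))" if e: "e \<in> onb" for e
      unfolding Cauchy_def dist_norm
    proof (intro allI impI)
      fix \<epsilon> :: real assume "\<epsilon> > 0"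
      then obtain N where N: "\<And>m n. \<lbrakk>N \<le> m; N \<le> n\<rbrakk> \<Longrightarrow> ball_dist (\<sigma> m) (\<sigma> n) < \<epsilon>"
        using \<sigma> unfolding MCauchy_def by meson
      have "cmod (ip e (\<sigma> m) - ip e (\<sigma> n)) < \<epsilon>" if "N \<le> m" "N \<le> n" for m n
        using cmod_coeff_le[of "\<sigma> m - \<sigma> n" e] N[OF that] \<sigma>X e
        by (simp add: ball_dist_def ip_diff)
      then show "\<exists>M. \<forall>m\<ge>M. \<forall>n\<ge>M. cmod (ip e (\<sigma> m) - ip e (\<sigma> n)) < \<epsilon>" by blast
    qed
    then have "\<forall>e\<in>onb. \<exists>c. (\<lambda>n. ip e (\<sigma> n)) \<longlonglongrightarrow> c"
      by (simp add: Cauchy_convergent_iff convergent_def)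
    then obtain c where c: "\<And>e. e \<in> onb \<Longrightarrow> (\<lambda>n. ip e (\<sigma> n)) \<longlonglongrightarrow> c e"
      by metis
    define x where "x = (\<Sum>e\<in>onb. c e \<odot> e)"
    have xX: "x \<in> X" by (simp add: x_def)
    have ipx: "ip e x = c e" if e: "e \<in> onb" for e
    proof -
      have "ip e x = (\<Sum>f\<in>onb. c f * ip e f)"
        unfolding x_def using e by (subst ip_sum) (auto simp: ip_scale)
      also have "\<dots> = (\<Sum>f\<in>onb. if f = e then c e else 0)"
        using onb(3) e by (intro sum.cong) (auto simp: orthonormal_def)
      finally show ?thesis using e onb(1) by simp
    qed
    have upper: "(\<lambda>n. \<Sum>e\<in>onb. cmod (ip e (\<sigma> n) - c e)) \<longlonglongrightarrow> (\<Sum>e\<in>onb. cmod (c e - c e))"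
      using c by (intro tendsto_intros)
    have lim: "(\<lambda>n. nrm (\<sigma> n - x)) \<longlonglongrightarrow> 0"
    proof (rule tendsto_sandwich[OF _ _ tendsto_const])
      show "\<forall>\<^sub>F n in sequentially. 0 \<le> nrm (\<sigma> n - x)"
        using \<sigma>X xX by simp
      show "\<forall>\<^sub>F n in sequentially. nrm (\<sigma> n - x) \<le> (\<Sum>e\<in>onb. cmod (ip e (\<sigma> n) - c e))"
      proof (intro always_eventually allI)
        fix n
        have "(\<Sum>e\<in>onb. cmod (ip e (\<sigma> n - x))) = (\<Sum>e\<in>onb. cmod (ip e (\<sigma> n) - c e))"
          using \<sigma>X xX ipx by (intro sum.cong) (auto simp: ip_diff)
        then show "nrm (\<sigma> n - x) \<le> (\<Sum>e\<in>onb. cmod (ip e (\<sigma> n) - c e))"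
          using nrm_le_sum[of "\<sigma> n - x"] \<sigma>X xX by simp
      qed
    qed (use upper in simp)
    have "nrm x \<le> r"
    proof (rule tendsto_lowerbound[of "\<lambda>n. r + nrm (\<sigma> n - x)" r])
      show "(\<lambda>n. r + nrm (\<sigma> n - x)) \<longlonglongrightarrow> r" using tendsto_add[OF tendsto_const lim] by simp
      show "\<forall>\<^sub>F n in sequentially. nrm x \<le> r + nrm (\<sigma> n - x)"
      proof (intro always_eventually allI)
        fix n
        show "nrm x \<le> r + nrm (\<sigma> n - x)"
          using nrm_triangle[of "\<sigma> n" "x - \<sigma> n"] nrm_minus_commute[of x "\<sigma> n"] \<sigma>X[of n] \<sigma>r[of n] xX
          by simp
      qed
    qed simp
    then show "\<exists>x. limitin mtopology \<sigma> x sequentially"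
      using xX lim \<sigma>X \<sigma>r by (intro exI[of _ x]) (simp add: limitin_metric_dist_null ball_dist_def)
  qed
qed

end

section \<open>One step of a mass-conserving implicit scheme\<close>

text \<open>\<open>G \<phi> a b\<close> is the right-hand side of the weak equation for the step from \<open>a\<close> to \<open>b\<close>, tested with
\<open>\<phi>\<close>. Its structure is that of a self-adjoint operator, depending on \<open>a\<close> and \<open>b\<close>, applied to their
midpoint. Two consequences are recorded: it vanishes when the midpoint does (\<open>G_zero_midpoint\<close>),
and it is real when tested with the midpoint itself (\<open>G_midpoint_real\<close>).\<close>

locale conservative_scheme = finite_dim_inner_space scale B X ip
  for scale :: "complex \<Rightarrow> 'v::ab_group_add \<Rightarrow> 'v" (infixr \<open>\<odot>\<close> 75) and B X ip +
  fixes G :: "'v \<Rightarrow> 'v \<Rightarrow> 'v \<Rightarrow> complex"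
  assumes G_add: "\<lbrakk>\<phi> \<in> X; \<psi> \<in> X; a \<in> X; b \<in> X\<rbrakk> \<Longrightarrow> G (\<phi> + \<psi>) a b = G \<phi> a b + G \<psi> a b"
    and G_scale: "\<lbrakk>\<phi> \<in> X; a \<in> X; b \<in> X\<rbrakk> \<Longrightarrow> G (c \<odot> \<phi>) a b = cnj c * G \<phi> a b"
    and G_zero_midpoint: "\<lbrakk>\<phi> \<in> X; a \<in> X\<rbrakk> \<Longrightarrow> G \<phi> a (- a) = 0"
    and G_local_Lipschitz: "\<phi> \<in> X \<Longrightarrow> \<exists>K. \<forall>a\<in>X. \<forall>b\<in>X. \<forall>b'\<in>X.
        nrm a \<le> R \<longrightarrow> nrm b \<le> R \<longrightarrow> nrm b' \<le> R \<longrightarrow> cmod (G \<phi> a b - G \<phi> a b') \<le> K * nrm (b - b')"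
    and G_midpoint_real: "\<lbrakk>a \<in> X; b \<in> X\<rbrakk> \<Longrightarrow> G ((1/2) \<odot> (b + a)) a b \<in> \<real>"
begin

definition step :: "real \<Rightarrow> 'v \<Rightarrow> 'v \<Rightarrow> bool" where
  "step \<tau> a b \<longleftrightarrow> b \<in> X \<and>
     (\<forall>\<phi>\<in>X. \<i> * ip \<phi> ((1 / complex_of_real \<tau>) \<odot> (b - a)) = G \<phi> a b)"

text \<open>Test with the midpoint \<open>m = (b + a) / 2\<close>. The right-hand side is real, so \<open>ip m (b - a)\<close> has
vanishing real part; but this real part is half the difference of the squared norms of \<open>b\<close> and
\<open>a\<close>.\<close>

lemma step_conserves_nrm:
  assumes "a \<in> X" "step \<tau> a b" "\<tau> > 0" shows "nrm b = nrm a"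
proof -
  have bX: "b \<in> X" using assms by (simp add: step_def)
  define m where "m = (1/2) \<odot> (b + a)"
  have mX: "m \<in> X" using assms(1) bX by (simp add: m_def)
  have "\<i> * ip m ((1 / complex_of_real \<tau>) \<odot> (b - a)) \<in> \<real>"
    using assms(2) mX G_midpoint_real[OF assms(1) bX] by (simp add: step_def m_def)
  then have "Re (ip m (b - a)) = 0"
    using assms mX bX by (simp add: ip_scale complex_is_Real_iff)
  moreover have "ip m (b - a) = (ip b b - ip a a + (ip a b - ip b a)) / 2"
    using assms(1) bX by (simp add: m_def ip_scale_left ip_add_left ip_diff field_simps)
  moreover have "Re (ip a b - ip b a) = 0"
    using ip_cnj[OF assms(1) bX] by simp
  ultimately have "Re (ip b b) = Re (ip a a)" by simp
  then show ?thesis by (simp add: nrm_def)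
qed

text \<open>The Riesz representative of the antilinear functional \<open>\<phi> \<mapsto> G \<phi> a b\<close>. With it the weak equation
becomes an equation in \<open>X\<close>, which \<open>step_iff\<close> states as a fixed-point equation for \<open>b\<close>.\<close>

definition riesz :: "'v \<Rightarrow> 'v \<Rightarrow> 'v" where
  "riesz a b = (\<Sum>e\<in>onb. G e a b \<odot> e)"

lemma riesz_in_X [simp]: "riesz a b \<in> X"
  by (simp add: riesz_def)

lemma ip_riesz:
  assumes "\<phi> \<in> X" "a \<in> X" "b \<in> X" shows "ip \<phi> (riesz a b) = G \<phi> a b"
proof -
  have G_sum: "G (sum f A) a b = (\<Sum>i\<in>A. G (f i) a b)" if "finite A" "\<And>i. i \<in> A \<Longrightarrow> f i \<in> X" for f and A :: "'v set"
    using that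
  proof (induction A)
    case empty
    then show ?case using G_scale[of 0 a b 0] assms by simp
  next
    case (insert x F)
    then show ?case using assms by (simp add: G_add)
  qed
  have "G \<phi> a b = G (\<Sum>e\<in>onb. ip e \<phi> \<odot> e) a b"
    by (rule arg_cong[OF onb_expansion[OF assms(1)], of "\<lambda>\<phi>. G \<phi> a b"])
  also have "\<dots> = (\<Sum>e\<in>onb. cnj (ip e \<phi>) * G e a b)"
    using assms by (subst G_sum) (auto simp: onb G_scale)
  also have "\<dots> = (\<Sum>e\<in>onb. G e a b * ip \<phi> e)"
    by (intro sum.cong refl) (simp add: ip_cnj[OF onb_in_X assms(1)] mult.commute)
  also have "\<dots> = ip \<phi> (riesz a b)"
    unfolding riesz_def using assms by (subst ip_sum) (auto simp: ip_scale)
  finally show ?thesis by simp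
qed

lemma step_iff:
  assumes "a \<in> X" "b \<in> X" "\<tau> > 0"
  shows "step \<tau> a b \<longleftrightarrow> b = a - (\<i> * complex_of_real \<tau>) \<odot> riesz a b"
proof -
  define r where "r = b - a + (\<i> * complex_of_real \<tau>) \<odot> riesz a b"
  have rX: "r \<in> X" using assms by (simp add: r_def)
  have key: "\<i> * ip \<phi> ((1 / complex_of_real \<tau>) \<odot> (b - a)) - G \<phi> a b = \<i> / complex_of_real \<tau> * ip \<phi> r"
    if "\<phi> \<in> X" for \<phi>
    using assms that by (simp add: r_def ip_diff ip_add ip_scale ip_riesz field_simps)
  have "step \<tau> a b \<longleftrightarrow> (\<forall>\<phi>\<in>X. ip \<phi> r = 0)"
    using key assms by (auto simp: step_def)
  also have "\<dots> \<longleftrightarrow> r = 0"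
    using ip_pos[OF rX] rX by force
  finally show ?thesis by (auto simp: r_def algebra_simps)
qed

text \<open>The bound on the size follows from the Lipschitz bound by comparing \<open>b\<close> with \<open>- a\<close>, for which
the representative vanishes.\<close>

lemma riesz_local_bounds:
  obtains K where "K > 0"
    "\<And>a b. \<lbrakk>a \<in> X; b \<in> X; nrm a \<le> R; nrm b \<le> R\<rbrakk> \<Longrightarrow> nrm (riesz a b) \<le> K"
    "\<And>a b b'. \<lbrakk>a \<in> X; b \<in> X; b' \<in> X; nrm a \<le> R; nrm b \<le> R; nrm b' \<le> R\<rbrakk>
       \<Longrightarrow> nrm (riesz a b - riesz a b') \<le> K * nrm (b - b')"
proof -
  have "\<forall>e\<in>onb. \<exists>K. \<forall>a\<in>X. \<forall>b\<in>X. \<forall>b'\<in>X.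
        nrm a \<le> R \<longrightarrow> nrm b \<le> R \<longrightarrow> nrm b' \<le> R \<longrightarrow> cmod (G e a b - G e a b') \<le> K * nrm (b - b')"
    using G_local_Lipschitz[of _ R] by simp
  then obtain K2 where K2: "\<And>e a b b'. \<lbrakk>e \<in> onb; a \<in> X; b \<in> X; b' \<in> X; nrm a \<le> R; nrm b \<le> R; nrm b' \<le> R\<rbrakk>
        \<Longrightarrow> cmod (G e a b - G e a b') \<le> K2 e * nrm (b - b')"
    unfolding bchoice_iff by blast
  have lip: "nrm (riesz a b - riesz a b') \<le> (\<Sum>e\<in>onb. \<bar>K2 e\<bar>) * nrm (b - b')"
    if "a \<in> X" "b \<in> X" "b' \<in> X" "nrm a \<le> R" "nrm b \<le> R" "nrm b' \<le> R" for a b b'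
  proof -
    have "nrm (riesz a b - riesz a b') \<le> (\<Sum>e\<in>onb. cmod (ip e (riesz a b - riesz a b')))"
      by (rule nrm_le_sum) simp
    also have "\<dots> \<le> (\<Sum>e\<in>onb. \<bar>K2 e\<bar> * nrm (b - b'))"
    proof (rule sum_mono)
      fix e assume e: "e \<in> onb"
      have "cmod (ip e (riesz a b - riesz a b')) \<le> K2 e * nrm (b - b')"
        using K2[OF e] that e by (simp add: ip_riesz ip_diff)
      also have "\<dots> \<le> \<bar>K2 e\<bar> * nrm (b - b')" using that by (intro mult_right_mono) auto
      finally show "cmod (ip e (riesz a b - riesz a b')) \<le> \<bar>K2 e\<bar> * nrm (b - b')" .
    qed
    finally show ?thesis by (simp add: sum_distrib_right)
  qed
  define K where "K = (1 + (\<Sum>e\<in>onb. \<bar>K2 e\<bar>)) * (1 + 2 * \<bar>R\<bar>)"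
  have L_nonneg: "0 \<le> (\<Sum>e\<in>onb. \<bar>K2 e\<bar>)" by (simp add: sum_nonneg)
  then have K_ge: "(\<Sum>e\<in>onb. \<bar>K2 e\<bar>) \<le> K" "(\<Sum>e\<in>onb. \<bar>K2 e\<bar>) * (2 * \<bar>R\<bar>) \<le> K" "K > 0"
    unfolding K_def by (auto simp: algebra_simps add_pos_nonneg add_nonneg_pos)
  show thesis
  proof
    show "K > 0" by (rule K_ge)
    fix a b assume ab: "a \<in> X" "b \<in> X" "nrm a \<le> R" "nrm b \<le> R"
    have ma: "- a \<in> X" "nrm (- a) = nrm a"
      using subspace_neg[OF subspace_X ab(1)] nrm_minus_commute[of 0 a] ab(1) by auto
    have "riesz a (- a) = 0" using ab(1) by (simp add: riesz_def G_zero_midpoint)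
    then have "nrm (riesz a b) = nrm (riesz a b - riesz a (- a))" by simp
    also have "\<dots> \<le> (\<Sum>e\<in>onb. \<bar>K2 e\<bar>) * nrm (b - - a)"
      using ab ma by (intro lip) auto
    also have "\<dots> \<le> (\<Sum>e\<in>onb. \<bar>K2 e\<bar>) * (2 * \<bar>R\<bar>)"
      using nrm_triangle[of b a] ab L_nonneg by (intro mult_left_mono) auto
    finally show "nrm (riesz a b) \<le> K" using K_ge by simp
    fix b' assume b': "b' \<in> X" "nrm b' \<le> R"
    have "nrm (riesz a b - riesz a b') \<le> (\<Sum>e\<in>onb. \<bar>K2 e\<bar>) * nrm (b - b')"
      using ab b' by (intro lip)
    also have "\<dots> \<le> K * nrm (b - b')" using K_ge ab b' by (intro mult_right_mono) auto
    finally show "nrm (riesz a b - riesz a b') \<le> K * nrm (b - b')" .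
  qed
qed

text \<open>For \<open>\<tau> \<le> 1 / (2 * K)\<close> the fixed-point map sends the ball of radius \<open>R + 1\<close> to itself, since it
moves away from \<open>a\<close> by at most \<open>\<tau> * K \<le> 1 / 2\<close>, and contracts by the factor \<open>1 / 2\<close>. Uniqueness
holds in all of \<open>X\<close> because conservation of the norm forces any solution into that ball. The
threshold depends on \<open>a\<close> only through its norm.\<close>

lemma step_uniquely_solvable:
  obtains \<tau>\<^sub>0 where "\<tau>\<^sub>0 > 0"
    "\<And>\<tau> a. \<lbrakk>0 < \<tau>; \<tau> \<le> \<tau>\<^sub>0; a \<in> X; nrm a = R\<rbrakk> \<Longrightarrow> \<exists>!b. step \<tau> a b"
proof -
  obtain K where K: "K > 0"
    "\<And>a b. \<lbrakk>a \<in> X; b \<in> X; nrm a \<le> R + 1; nrm b \<le> R + 1\<rbrakk> \<Longrightarrow> nrm (riesz a b) \<le> K"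
    "\<And>a b b'. \<lbrakk>a \<in> X; b \<in> X; b' \<in> X; nrm a \<le> R + 1; nrm b \<le> R + 1; nrm b' \<le> R + 1\<rbrakk>
       \<Longrightarrow> nrm (riesz a b - riesz a b') \<le> K * nrm (b - b')"
    using riesz_local_bounds[of "R + 1"] by blast
  show thesis
  proof
    show "1 / (2 * K) > 0" using K by simp
    fix \<tau> a assume \<tau>: "0 < \<tau>" "\<tau> \<le> 1 / (2 * K)" and a: "a \<in> X" "nrm a = R"
    have \<tau>K: "\<tau> * K \<le> 1 / 2" using \<tau> K by (simp add: field_simps)
    define M where "M = {x \<in> X. nrm x \<le> R + 1}"
    define f where "f b = a - (\<i> * complex_of_real \<tau>) \<odot> riesz a b" for b
    have f_diff: "f b - f b' = (\<i> * complex_of_real \<tau>) \<odot> (riesz a b' - riesz a b)" for b b'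
      by (simp add: f_def scale_right_diff_distrib)
    have nrm_shift: "nrm ((\<i> * complex_of_real \<tau>) \<odot> x) = \<tau> * nrm x" if "x \<in> X" for x
      using that \<tau> by (simp add: nrm_scale norm_mult)
    have fM: "f b \<in> M" if "b \<in> M" for b
    proof -
      have "nrm (f b) \<le> nrm a + \<tau> * nrm (riesz a b)"
        unfolding f_def using nrm_add_diff_le[of a 0 "(\<i> * complex_of_real \<tau>) \<odot> riesz a b"] a(1)
          nrm_minus_commute[of 0 "(\<i> * complex_of_real \<tau>) \<odot> riesz a b"] nrm_shift[of "riesz a b"]
        by simp
      also have "\<dots> \<le> R + \<tau> * K"
        using K(2)[of a b] a that \<tau> by (auto simp: M_def)
      finally show ?thesis using \<tau>K a by (simp add: M_def f_def)
    qed
    have contr: "ball_dist (f b) (f b') \<le> 1/2 * ball_dist b b'" if "b \<in> M" "b' \<in> M" for b b'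
    proof -
      have "nrm (f b - f b') \<le> \<tau> * (K * nrm (b - b'))"
        unfolding f_diff using that K(3)[of a b' b] nrm_minus_commute[of b b'] a \<tau> by (subst nrm_shift) (auto simp: M_def)
      also have "\<dots> \<le> 1/2 * nrm (b - b')"
        using mult_right_mono[OF \<tau>K, of "nrm (b - b')"] that by (simp add: M_def mult.assoc)
      finally show ?thesis using that fM by (auto simp: ball_dist_def M_def)
    qed
    interpret Metric_space M ball_dist unfolding M_def by (rule Metric_space_ball)
    have "a \<in> M" using a by (simp add: M_def)
    obtain b where b: "b \<in> M" "f b = b"
      by (rule Banach_fixedpoint_thm[of f "1/2"])
        (use mcomplete_ball[of "R + 1"] \<open>a \<in> M\<close> fM contr in \<open>auto simp: M_def\<close>)
    have step_f: "step \<tau> a c \<longleftrightarrow> f c = c" if "c \<in> X" for c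
      using step_iff[OF a(1) that \<tau>(1)] by (auto simp: f_def)
    show "\<exists>!b. step \<tau> a b"
    proof
      show "step \<tau> a b" using b step_f by (simp add: M_def)
      fix c assume c: "step \<tau> a c"
      have "c \<in> X" using c by (simp add: step_def)
      moreover have "nrm c = R" using step_conserves_nrm[OF a(1) c \<tau>(1)] a by simp
      ultimately have "c \<in> M" "f c = c" using step_f c by (auto simp: M_def)
      then have "ball_dist c b \<le> 1/2 * ball_dist c b"
        using contr[of c b] b by simp
      then have "ball_dist c b = 0" using nonneg[of c b] by linarith
      then show "c = b" using b \<open>c \<in> M\<close> by simp
    qed
  qed
qed

end

text \<open>A time step that is uniquely solvable on a set which it preserves determines the whole
trajectory. Extensionality in \<open>{0..N} \<rightarrow>\<^sub>E X\<close> makes trajectories unique as functions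
on all natural numbers.\<close>

lemma unique_iteration:
  fixes P :: "'v \<Rightarrow> 'v \<Rightarrow> bool"
  assumes "x \<in> Q" and ex: "\<And>a. a \<in> Q \<Longrightarrow> \<exists>!b. P a b"
    and closed: "\<And>a b. \<lbrakk>a \<in> Q; P a b\<rbrakk> \<Longrightarrow> b \<in> Q" and "Q \<subseteq> X"
  shows "\<exists>!\<Psi>. \<Psi> \<in> {0..N::nat} \<rightarrow>\<^sub>E X \<and> \<Psi> 0 = x \<and> (\<forall>n\<in>{1..N}. P (\<Psi> (n - 1)) (\<Psi> n))"
proof -
  define \<Phi> where "\<Phi> = rec_nat x (\<lambda>n a. THE b. P a b)"
  have \<Phi>0: "\<Phi> 0 = x" and \<Phi>Suc: "\<Phi> (Suc n) = (THE b. P (\<Phi> n) b)" for n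
    by (simp_all add: \<Phi>_def)
  have \<Phi>P: "P (\<Phi> n) (\<Phi> (Suc n))" if "\<Phi> n \<in> Q" for n
    unfolding \<Phi>Suc using theI'[OF ex[OF that]] .
  have \<Phi>Q: "\<Phi> n \<in> Q" for n
    by (induction n) (use assms(1) \<Phi>0 \<Phi>P closed in auto)
  define \<Psi> where "\<Psi> = restrict \<Phi> {0..N}"
  show ?thesis
  proof
    have "P (\<Psi> (n - 1)) (\<Psi> n)" if "n \<in> {1..N}" for n
      using \<Phi>P[OF \<Phi>Q, of "n - 1"] that by (auto simp: \<Psi>_def)
    then show "\<Psi> \<in> {0..N} \<rightarrow>\<^sub>E X \<and> \<Psi> 0 = x \<and> (\<forall>n\<in>{1..N}. P (\<Psi> (n - 1)) (\<Psi> n))"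
      using \<Phi>Q \<open>Q \<subseteq> X\<close> \<Phi>0 by (auto simp: \<Psi>_def)
  next
    fix \<Psi>' assume \<Psi>': "\<Psi>' \<in> {0..N} \<rightarrow>\<^sub>E X \<and> \<Psi>' 0 = x \<and> (\<forall>n\<in>{1..N}. P (\<Psi>' (n - 1)) (\<Psi>' n))"
    have eq: "\<Psi>' n = \<Phi> n" if "n \<le> N" for n
      using that
    proof (induction n)
      case 0
      then show ?case using \<Psi>' \<Phi>0 by simp
    next
      case (Suc n)
      then have "P (\<Phi> n) (\<Psi>' (Suc n))"
        using \<Psi>' by (metis Suc_leD atLeastAtMost_iff diff_Suc_1 le_add1 plus_1_eq_Suc)
      then show ?case using ex[OF \<Phi>Q[of n]] \<Phi>P[OF \<Phi>Q[of n]] by blast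
    qed
    show "\<Psi>' = \<Psi>"
    proof
      fix n show "\<Psi>' n = \<Psi> n"
        using eq \<Psi>' by (cases "n \<le> N") (auto simp: \<Psi>_def PiE_def extensional_def)
    qed
  qed
qed

section \<open>Smooth bump functions and the fundamental lemma of the calculus of variations\<close>

text \<open>For \<open>k = 0\<close> this is the classical smooth function that is flat at the origin. The family is
indexed by \<open>k\<close> so that the derivative of a member is a combination of members.\<close>

definition flat_exp :: "nat \<Rightarrow> real \<Rightarrow> real" where
  "flat_exp k t = (if 0 < t then inverse t ^ k * exp (- inverse t) else 0)"

lemma flat_exp_tendsto_0: "(flat_exp k \<longlongrightarrow> 0) (at 0)"
proof -
  have "((\<lambda>t. inverse t ^ k / exp (inverse t)) \<longlongrightarrow> 0) (at_right (0::real))"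
    by (rule filterlim_compose[OF tendsto_power_div_exp_0 filterlim_inverse_at_top_right])
  moreover have "\<forall>\<^sub>F t in at_right 0. inverse t ^ k / exp (inverse t) = flat_exp k t"
    using eventually_at_right_less[of 0]
    by eventually_elim (simp add: flat_exp_def exp_minus divide_inverse)
  ultimately have right: "(flat_exp k \<longlongrightarrow> 0) (at_right 0)"
    by (rule Lim_transform_eventually)
  have "\<forall>\<^sub>F t in at_left 0. 0 = flat_exp k t"
    unfolding eventually_at_filter by (simp add: flat_exp_def)
  then have "(flat_exp k \<longlongrightarrow> 0) (at_left 0)"
    by (rule Lim_transform_eventually[OF tendsto_const])
  with right show ?thesis by (simp add: filterlim_split_at)
qed

lemma flat_exp_has_derivative:
  "(flat_exp k has_real_derivative (flat_exp (k + 2) t - real k * flat_exp (k + 1) t)) (at t)"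
proof -
  consider "t > 0" | "t < 0" | "t = 0" by linarith
  then show ?thesis
  proof cases
    case 1
    have "((\<lambda>t. inverse t ^ k * exp (- inverse t)) has_real_derivative
        (flat_exp (k + 2) t - real k * flat_exp (k + 1) t)) (at t)"
    proof -
      have inv: "(inverse has_real_derivative - (inverse t)\<^sup>2) (at t)"
        using 1 DERIV_inverse[of t UNIV] by (simp add: numeral_2_eq_2)
      have pow: "((\<lambda>t. inverse t ^ k) has_real_derivative real k * (- (inverse t)\<^sup>2 * inverse t ^ (k - Suc 0))) (at t)"
        using DERIV_power[OF inv, of k] by simp
      have "((\<lambda>t. exp (- inverse t)) has_real_derivative exp (- inverse t) * (inverse t)\<^sup>2) (at t)"
        using DERIV_chain2[OF DERIV_exp DERIV_minus[OF inv]] by simp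
      from DERIV_mult[OF pow this] show ?thesis
        by (rule back_subst[where P = "\<lambda>D. (_ has_real_derivative D) _"])
          (use 1 in \<open>cases k; simp add: flat_exp_def power2_eq_square algebra_simps\<close>)
    qed
    then show ?thesis
      by (rule has_field_derivative_transform_within_open[of _ _ _ "{0<..}"])
        (use 1 in \<open>auto simp: flat_exp_def\<close>)
  next
    case 2
    have "((\<lambda>t. 0) has_real_derivative (flat_exp (k + 2) t - real k * flat_exp (k + 1) t)) (at t)"
      using 2 by (simp add: flat_exp_def)
    then show ?thesis
      by (rule has_field_derivative_transform_within_open[of _ _ _ "{..<0}"])
        (use 2 in \<open>auto simp: flat_exp_def\<close>)
  next
    case 3
    have "flat_exp (Suc k) = (\<lambda>h. (flat_exp k (0 + h) - flat_exp k 0) / h)"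
      by (simp add: flat_exp_def divide_inverse fun_eq_iff)
    with flat_exp_tendsto_0[of "Suc k"] have "(flat_exp k has_real_derivative 0) (at 0)"
      by (simp only: DERIV_def)
    with 3 show ?thesis by (simp add: flat_exp_def)
  qed
qed

text \<open>An algebra of functions that is closed under partial derivatives, so that all its members are
smooth by induction on the order of differentiability, with no calculus of higher derivatives.\<close>

inductive bump_algebra :: "('a::euclidean_space \<Rightarrow> complex) \<Rightarrow> bool" where
  const: "bump_algebra (\<lambda>x. c)"
| flat: "bump_algebra (\<lambda>x. complex_of_real (flat_exp k (u \<bullet> x + r)))"
| add: "bump_algebra f \<Longrightarrow> bump_algebra g \<Longrightarrow> bump_algebra (\<lambda>x. f x + g x)"
| mult: "bump_algebra f \<Longrightarrow> bump_algebra g \<Longrightarrow> bump_algebra (\<lambda>x. f x * g x)"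

lemma bump_algebra_prod:
  "(\<And>i. i \<in> A \<Longrightarrow> bump_algebra (f i)) \<Longrightarrow> bump_algebra (\<lambda>x. \<Prod>i\<in>A. f i x)"
  by (induction A rule: infinite_finite_induct) (auto intro: bump_algebra.intros)

lemma bump_algebra_derivative:
  assumes "bump_algebra f"
  shows "\<exists>D. (\<forall>x. (f has_derivative D x) (at x)) \<and> (\<forall>i. bump_algebra (\<lambda>x. D x i))"
  using assms
proof induction
  case (const c)
  show ?case
    by (intro exI[of _ "\<lambda>x i. 0"]) (auto intro: bump_algebra.const)
next
  case (flat k u r)
  let ?D = "\<lambda>x i. complex_of_real (u \<bullet> i) * (complex_of_real (flat_exp (k + 2) (u \<bullet> x + r))
      + complex_of_real (- real k) * complex_of_real (flat_exp (k + 1) (u \<bullet> x + r)))"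
  have "((\<lambda>x. complex_of_real (flat_exp k (u \<bullet> x + r))) has_derivative ?D x) (at x)" for x
  proof -
    have "((\<lambda>x. flat_exp k (u \<bullet> x + r)) has_derivative
        (\<lambda>h. (flat_exp (k + 2) (u \<bullet> x + r) - real k * flat_exp (k + 1) (u \<bullet> x + r)) * (u \<bullet> h))) (at x)"
      by (rule has_derivative_compose[OF _ flat_exp_has_derivative[unfolded has_field_derivative_def],
            of "\<lambda>x. u \<bullet> x + r" "\<lambda>h. u \<bullet> h"])
        (auto intro!: derivative_eq_intros)
    then have "((\<lambda>x. complex_of_real (flat_exp k (u \<bullet> x + r))) has_derivative
        (\<lambda>h. complex_of_real ((flat_exp (k + 2) (u \<bullet> x + r) - real k * flat_exp (k + 1) (u \<bullet> x + r)) * (u \<bullet> h)))) (at x)"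
      by (rule has_derivative_of_real)
    then show ?thesis by (simp add: algebra_simps)
  qed
  moreover have "bump_algebra (\<lambda>x. ?D x i)" for i
    by (intro bump_algebra.intros)
  ultimately show ?case by (intro exI[of _ ?D]) simp
next
  case (add f g)
  then obtain D E where "\<And>x. (f has_derivative D x) (at x)" "\<And>x. (g has_derivative E x) (at x)"
    "\<And>i. bump_algebra (\<lambda>x. D x i)" "\<And>i. bump_algebra (\<lambda>x. E x i)"
    by metis
  then show ?case
    by (intro exI[of _ "\<lambda>x i. D x i + E x i"]) (auto intro: has_derivative_add bump_algebra.add)
next
  case (mult f g)
  then obtain D E where "\<And>x. (f has_derivative D x) (at x)" "\<And>x. (g has_derivative E x) (at x)"
    "\<And>i. bump_algebra (\<lambda>x. D x i)" "\<And>i. bump_algebra (\<lambda>x. E x i)"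
    by metis
  with mult.hyps show ?case
    by (intro exI[of _ "\<lambda>x i. f x * E x i + D x i * g x"])
      (auto intro!: has_derivative_mult bump_algebra.add bump_algebra.mult)
qed

lemma bump_algebra_smooth:
  assumes "bump_algebra f" shows "smooth_on UNIV f"
proof -
  have "C_on k UNIV f" for k
    using assms
  proof (induction k arbitrary: f)
    case 0
    then obtain D where "\<And>x. (f has_derivative D x) (at x)"
      using bump_algebra_derivative by blast
    then show ?case
      using has_derivative_continuous_on[of UNIV f D] by simp
  next
    case (Suc k)
    obtain D where D: "\<And>x. (f has_derivative D x) (at x)" "\<And>i. bump_algebra (\<lambda>x. D x i)"
      using bump_algebra_derivative[OF Suc.prems] by blast
    have "partial_deriv i f = (\<lambda>x. D x i)" for i
      using frechet_derivative_at[OF D(1)] by (simp add: partial_deriv_def fun_eq_iff)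
    then show ?case using D Suc.IH by (auto simp: differentiable_def)
  qed
  then show ?thesis by (simp add: smooth_on_def)
qed

text \<open>As \<open>flat_exp 0 (n * t)\<close> is \<open>exp (- 1 / (n * t))\<close> for \<open>t > 0\<close> and \<open>0\<close> otherwise, it increases to
the indicator of the positive half-line. Products over the faces of a box give smooth
approximations of its indicator from inside.\<close>

definition box_bump :: "'a::euclidean_space \<Rightarrow> 'a \<Rightarrow> nat \<Rightarrow> 'a \<Rightarrow> real" where
  "box_bump a b n x =
     (\<Prod>i\<in>Basis. flat_exp 0 (real (Suc n) * (x \<bullet> i - a \<bullet> i)) * flat_exp 0 (real (Suc n) * (b \<bullet> i - x \<bullet> i)))"

lemma flat_exp_0_bounds: "0 \<le> flat_exp 0 t" "flat_exp 0 t \<le> 1" "flat_exp 0 t = 0 \<longleftrightarrow> t \<le> 0"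
  by (auto simp: flat_exp_def)

lemma box_bump_bounds: "0 \<le> box_bump a b n x" "box_bump a b n x \<le> 1"
  unfolding box_bump_def
  by (auto intro!: prod_nonneg prod_le_1 mult_nonneg_nonneg mult_le_one flat_exp_0_bounds)

lemma box_bump_eq_0: "x \<notin> box a b \<Longrightarrow> box_bump a b n x = 0"
  by (force simp: box_bump_def flat_exp_0_bounds mem_box zero_less_mult_iff not_less mult_le_0_iff)

lemma box_bump_tendsto: "(\<lambda>n. box_bump a b n x) \<longlonglongrightarrow> indicator (box a b) x"
proof (cases "x \<in> box a b")
  case True
  have flat_lim: "(\<lambda>n. flat_exp 0 (real (Suc n) * t)) \<longlonglongrightarrow> 1" if "t > 0" for t
  proof -
    have "(\<lambda>n. exp (- (inverse (real (Suc n)) * inverse t))) \<longlonglongrightarrow> exp (- (0 * inverse t))"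
      by (intro tendsto_intros LIMSEQ_inverse_real_of_nat)
    then show ?thesis using that by (simp add: flat_exp_def del: of_nat_Suc)
  qed
  have "(\<lambda>n. box_bump a b n x) \<longlonglongrightarrow> (\<Prod>i\<in>(Basis::'a set). 1 * 1)"
    unfolding box_bump_def
    by (intro tendsto_intros flat_lim) (use True in \<open>auto simp: mem_box\<close>)
  then show ?thesis using True by simp
qed (simp add: box_bump_eq_0)

lemma box_bump_test_function:
  assumes "cbox a b \<subseteq> \<Omega>"
  shows "(\<lambda>x. complex_of_real (box_bump a b n x)) \<in> test_functions \<Omega>"
proof -
  have base: "bump_algebra (\<lambda>x. complex_of_real (flat_exp 0 (real (Suc n) * (x \<bullet> i - a \<bullet> i))) *
      complex_of_real (flat_exp 0 (real (Suc n) * (b \<bullet> i - x \<bullet> i))))" for i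
  proof -
    have "real (Suc n) * (x \<bullet> i - a \<bullet> i) = (real (Suc n) *\<^sub>R i) \<bullet> x + (- real (Suc n) * (a \<bullet> i))"
      "real (Suc n) * (b \<bullet> i - x \<bullet> i) = (- real (Suc n) *\<^sub>R i) \<bullet> x + real (Suc n) * (b \<bullet> i)" for x
      by (simp_all add: algebra_simps inner_commute del: of_nat_Suc)
    then show ?thesis by (simp only:) (intro bump_algebra.mult bump_algebra.flat)
  qed
  have "bump_algebra (\<lambda>x. complex_of_real (box_bump a b n x))"
    unfolding box_bump_def of_real_prod of_real_mult
    using base by (intro bump_algebra_prod) (simp only: of_real_mult)
  then have "smooth_on UNIV (\<lambda>x. complex_of_real (box_bump a b n x))"
    by (rule bump_algebra_smooth)
  moreover have "{x. complex_of_real (box_bump a b n x) \<noteq> 0} \<subseteq> cbox a b"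
    using box_bump_eq_0[of _ a b n] box_subset_cbox[of a b] by auto
  then have "closure {x. complex_of_real (box_bump a b n x) \<noteq> 0} \<subseteq> cbox a b"
    by (rule closure_minimal) (rule closed_cbox)
  ultimately show ?thesis
    using assms compact_Int_closed[OF compact_cbox[of a b], of "closure {x. complex_of_real (box_bump a b n x) \<noteq> 0}"]
    unfolding test_functions_def by (auto simp: Int_absorb1)
qed

lemma test_function_continuous: "\<phi> \<in> test_functions \<Omega> \<Longrightarrow> continuous_on UNIV \<phi>"
  unfolding test_functions_def smooth_on_def by (metis (no_types, lifting) C_on.simps(1) mem_Collect_eq)

text \<open>Dominated convergence along \<open>box_bump\<close> shows that the integral of \<open>g\<close> vanishes over every closed
box inside \<open>\<Omega>\<close>. By Lebesgue differentiation \<open>g x\<close> is, at almost every \<open>x\<close>, the limit of the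
averages of \<open>g\<close> over small boxes at \<open>x\<close>, which are all zero.\<close>

lemma fundamental_lemma_calculus_of_variations:
  fixes g :: "'a::euclidean_space \<Rightarrow> complex"
  assumes "open \<Omega>" and g: "integrable (lebesgue_on \<Omega>) g"
    and ortho: "\<And>\<phi>. \<phi> \<in> test_functions \<Omega> \<Longrightarrow> (LINT x|lebesgue_on \<Omega>. g x * \<phi> x) = 0"
  shows "AE x in lebesgue_on \<Omega>. g x = 0"
proof -
  have \<Omega>: "\<Omega> \<in> sets lebesgue" using assms(1) by (simp add: borel_open)
  define f where "f x = (if x \<in> \<Omega> then g x else 0)" for x
  have f_int: "f absolutely_integrable_on UNIV"
  proof -
    have "(\<lambda>x. indicator \<Omega> x *\<^sub>R g x) = f" by (auto simp: f_def indicator_def)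
    then show ?thesis
      using g \<Omega> by (simp add: set_integrable_def integrable_restrict_space)
  qed
  have box_zero: "integral (cbox a b) f = 0" if ab: "cbox a b \<subseteq> \<Omega>" for a b
  proof -
    have box: "box a b \<subseteq> \<Omega>" using ab box_subset_cbox by blast
    have "(\<lambda>x. complex_of_real (indicator (box a b) x)) \<in> borel_measurable (lebesgue_on \<Omega>)"
      by (intro measurable_restrict_space1 measurable_completion) simp
    then have ind_meas: "(\<lambda>x. g x * complex_of_real (indicator (box a b) x)) \<in> borel_measurable (lebesgue_on \<Omega>)"
      using g by simp
    have ind_int: "integrable (lebesgue_on \<Omega>) (\<lambda>x. g x * complex_of_real (indicator (box a b) x))"
      by (rule Bochner_Integration.integrable_bound[OF g ind_meas])
        (auto simp: norm_mult indicator_def)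
    have "(\<lambda>n. LINT x|lebesgue_on \<Omega>. g x * complex_of_real (box_bump a b n x))
        \<longlonglongrightarrow> (LINT x|lebesgue_on \<Omega>. g x * complex_of_real (indicator (box a b) x))"
    proof (rule integral_dominated_convergence[where w = "\<lambda>x. norm (g x)"])
      show "AE x in lebesgue_on \<Omega>. (\<lambda>n. g x * complex_of_real (box_bump a b n x))
          \<longlonglongrightarrow> g x * complex_of_real (indicator (box a b) x)"
        by (intro AE_I2 tendsto_intros box_bump_tendsto)
      show "AE x in lebesgue_on \<Omega>. norm (g x * complex_of_real (box_bump a b n x)) \<le> norm (g x)" for n
        by (intro AE_I2) (simp add: norm_mult box_bump_bounds mult_left_le)
      show "integrable (lebesgue_on \<Omega>) (\<lambda>x. norm (g x))" using g by simp
      have "(\<lambda>x. complex_of_real (box_bump a b n x)) \<in> borel_measurable (lebesgue_on \<Omega>)" for n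
        using test_function_continuous[OF box_bump_test_function[OF ab], of n] \<Omega>
        by (intro continuous_imp_measurable_on_sets_lebesgue) (auto intro: continuous_on_subset)
      then show "(\<lambda>x. g x * complex_of_real (box_bump a b n x)) \<in> borel_measurable (lebesgue_on \<Omega>)" for n
        using g by simp
      show "(\<lambda>x. g x * complex_of_real (indicator (box a b) x)) \<in> borel_measurable (lebesgue_on \<Omega>)"
        by (rule ind_meas)
    qed
    then have "(LINT x|lebesgue_on \<Omega>. g x * complex_of_real (indicator (box a b) x)) = 0"
      using ortho[OF box_bump_test_function[OF ab]] by (simp add: LIMSEQ_const_iff)
    moreover have "(LINT x|lebesgue_on \<Omega>. g x * complex_of_real (indicator (box a b) x))
        = integral \<Omega> (\<lambda>x. g x * complex_of_real (indicator (box a b) x))"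
      by (rule lebesgue_integral_eq_integral[OF ind_int \<Omega>])
    moreover have "\<dots> = integral \<Omega> (\<lambda>x. if x \<in> box a b then f x else 0)"
      using box by (intro integral_cong) (auto simp: f_def)
    moreover have "\<dots> = integral (box a b) f" using box by (simp add: Henstock_Kurzweil_Integration.integral_restrict_Int Int_absorb2)
    ultimately show ?thesis by (simp add: integral_open_interval)
  qed
  have f_box: "f integrable_on cbox a b" for a b
    using f_int integrable_on_subcbox[of f UNIV a b] set_lebesgue_integral_eq_integral(1) by blast
  obtain N where N: "negligible N"
    "\<And>x e. \<lbrakk>x \<notin> N; 0 < e\<rbrakk> \<Longrightarrow> \<exists>d>0. \<forall>h. 0 < h \<and> h < d \<longrightarrow>
        norm (integral (cbox x (x + h *\<^sub>R One)) f /\<^sub>R h ^ DIM('a) - f x) < e"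
    using integrable_ccontinuous_explicit[OF f_box] by blast
  have zero: "g x = 0" if x: "x \<in> \<Omega>" "x \<notin> N" for x
  proof (rule ccontr)
    assume "g x \<noteq> 0"
    then have "norm (g x) > 0" by simp
    then obtain d where d: "d > 0" "\<And>h. \<lbrakk>0 < h; h < d\<rbrakk> \<Longrightarrow>
        norm (integral (cbox x (x + h *\<^sub>R One)) f /\<^sub>R h ^ DIM('a) - f x) < norm (g x)"
      using N(2)[OF x(2)] by blast
    obtain e where e: "e > 0" "cball x e \<subseteq> \<Omega>"
      using assms(1) x(1) open_contains_cball by blast
    \<comment> \<open>the cube with corner \<open>x\<close> and side \<open>h\<close> has diameter at most \<open>h * DIM('a)\<close>\<close>
    define h where "h = min (d / 2) (e / DIM('a))"
    have h: "0 < h" "h < d" "h * DIM('a) \<le> e"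
      using d e unfolding h_def by (auto simp: field_simps min_def)
    have "cbox x (x + h *\<^sub>R One) \<subseteq> cball x e"
    proof
      fix y assume y: "y \<in> cbox x (x + h *\<^sub>R One)"
      have "norm (y - x) \<le> (\<Sum>i\<in>Basis. \<bar>(y - x) \<bullet> i\<bar>)" by (rule norm_le_l1)
      also have "\<dots> \<le> (\<Sum>i\<in>(Basis::'a set). h)"
        using y by (intro sum_mono) (auto simp: mem_box inner_diff_left inner_add_left)
      also have "\<dots> \<le> e" using h by (simp add: mult.commute)
      finally show "y \<in> cball x e" by (simp add: dist_norm norm_minus_commute)
    qed
    then have "integral (cbox x (x + h *\<^sub>R One)) f = 0" using e by (intro box_zero) auto
    then show False using d(2)[OF h(1,2)] x(1) by (simp add: f_def)
  qed
  have "N \<in> null_sets lebesgue" using N(1) by (simp add: negligible_iff_null_sets)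
  then have "AE x in lebesgue. x \<notin> N" by (rule AE_not_in)
  then show ?thesis
    using \<Omega> zero by (auto simp: AE_restrict_space_iff elim!: eventually_mono)
qed

section \<open>Square-integrable functions and weak derivatives\<close>

lemma L2_mult_integrable:
  assumes "f \<in> L2 \<Omega>" "g \<in> L2 \<Omega>" shows "integrable (lebesgue_on \<Omega>) (\<lambda>x. f x * g x)"
proof (rule Bochner_Integration.integrable_bound)
  show "integrable (lebesgue_on \<Omega>) (\<lambda>x. (cmod (f x))\<^sup>2 + (cmod (g x))\<^sup>2)"
    using assms by (auto simp: L2_def)
  show "(\<lambda>x. f x * g x) \<in> borel_measurable (lebesgue_on \<Omega>)"
    using assms by (auto simp: L2_def)
  show "AE x in lebesgue_on \<Omega>. norm (f x * g x) \<le> norm ((cmod (f x))\<^sup>2 + (cmod (g x))\<^sup>2)"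
  proof (intro AE_I2)
    fix x
    have "2 * (cmod (f x) * cmod (g x)) \<le> (cmod (f x))\<^sup>2 + (cmod (g x))\<^sup>2"
      using sum_squares_bound[of "cmod (f x)" "cmod (g x)"] by (simp add: mult.assoc)
    moreover have "0 \<le> cmod (f x) * cmod (g x)" by simp
    ultimately have "cmod (f x) * cmod (g x) \<le> (cmod (f x))\<^sup>2 + (cmod (g x))\<^sup>2" by linarith
    then show "norm (f x * g x) \<le> norm ((cmod (f x))\<^sup>2 + (cmod (g x))\<^sup>2)"
      by (simp add: norm_mult)
  qed
qed

lemma L2_cnj: "f \<in> L2 \<Omega> \<Longrightarrow> (\<lambda>x. cnj (f x)) \<in> L2 \<Omega>"
  by (auto simp: L2_def intro: borel_measurable_continuous_onI[THEN measurable_compose[rotated]] continuous_intros)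

lemma L2_scale: "f \<in> L2 \<Omega> \<Longrightarrow> (\<lambda>x. c * f x) \<in> L2 \<Omega>"
  by (auto simp: L2_def norm_mult power_mult_distrib)

lemma L2_add:
  assumes "f \<in> L2 \<Omega>" "g \<in> L2 \<Omega>" shows "(\<lambda>x. f x + g x) \<in> L2 \<Omega>"
proof -
  have "integrable (lebesgue_on \<Omega>) (\<lambda>x. (cmod (f x + g x))\<^sup>2)"
  proof (rule Bochner_Integration.integrable_bound)
    show "integrable (lebesgue_on \<Omega>) (\<lambda>x. 2 * (cmod (f x))\<^sup>2 + 2 * (cmod (g x))\<^sup>2)"
      using assms by (auto simp: L2_def)
    show "(\<lambda>x. (cmod (f x + g x))\<^sup>2) \<in> borel_measurable (lebesgue_on \<Omega>)"
      using assms by (auto simp: L2_def)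
    show "AE x in lebesgue_on \<Omega>. norm ((cmod (f x + g x))\<^sup>2) \<le> norm (2 * (cmod (f x))\<^sup>2 + 2 * (cmod (g x))\<^sup>2)"
    proof (intro AE_I2)
      fix x
      have "(cmod (f x + g x))\<^sup>2 \<le> (cmod (f x) + cmod (g x))\<^sup>2"
        by (intro power_mono norm_triangle_ineq) simp
      also have "\<dots> \<le> 2 * (cmod (f x))\<^sup>2 + 2 * (cmod (g x))\<^sup>2"
        using zero_le_power2[of "cmod (f x) - cmod (g x)"] by (simp add: power2_sum power2_diff)
      finally show "norm ((cmod (f x + g x))\<^sup>2) \<le> norm (2 * (cmod (f x))\<^sup>2 + 2 * (cmod (g x))\<^sup>2)"
        by simp
    qed
  qed
  then show ?thesis using assms by (auto simp: L2_def)
qed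

lemma continuous_on_closure_integrable:
  fixes f :: "'a::euclidean_space \<Rightarrow> 'b::{banach, second_countable_topology}"
  assumes "open \<Omega>" "bounded \<Omega>" "continuous_on (closure \<Omega>) f"
  shows "integrable (lebesgue_on \<Omega>) f"
proof -
  have \<Omega>: "\<Omega> \<in> lmeasurable" using assms(1,2) by (simp add: lmeasurable_open)
  have "bounded (f ` closure \<Omega>)"
    using assms by (intro compact_imp_bounded compact_continuous_image) (auto simp: compact_closure)
  then obtain M where M: "\<And>x. x \<in> closure \<Omega> \<Longrightarrow> norm (f x) \<le> M"
    by (auto simp: bounded_iff)
  show ?thesis
  proof (rule Bochner_Integration.integrable_bound)
    show "integrable (lebesgue_on \<Omega>) (\<lambda>x. M)" by (rule finite_measure.integrable_const[OF finite_measure_lebesgue_on[OF \<Omega>]])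
    show "f \<in> borel_measurable (lebesgue_on \<Omega>)"
      using \<Omega> continuous_on_subset[OF assms(3) closure_subset]
      by (intro continuous_imp_measurable_on_sets_lebesgue fmeasurableD)
    show "AE x in lebesgue_on \<Omega>. norm (f x) \<le> norm M"
      using M closure_subset by (intro AE_I2) force
  qed
qed

lemma continuous_on_closure_L2:
  assumes "open \<Omega>" "bounded \<Omega>" "continuous_on (closure \<Omega>) f"
  shows "f \<in> L2 \<Omega>"
proof -
  have "continuous_on (closure \<Omega>) (\<lambda>x. (cmod (f x))\<^sup>2)"
    using assms(3) by (intro continuous_on_power continuous_on_norm)
  then show ?thesis
    using continuous_on_closure_integrable[OF assms] continuous_on_closure_integrable[OF assms(1,2)]
    by (auto simp: L2_def)
qed

lemma L2_inner_add:
  "\<lbrakk>f \<in> L2 \<Omega>; g \<in> L2 \<Omega>; k \<in> L2 \<Omega>\<rbrakk> \<Longrightarrow> L2_inner \<Omega> f (\<lambda>x. g x + k x) = L2_inner \<Omega> f g + L2_inner \<Omega> f k"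
  unfolding L2_inner_def
  by (simp add: distrib_left L2_mult_integrable L2_cnj)

lemma L2_inner_scale: "L2_inner \<Omega> f (\<lambda>x. c * g x) = c * L2_inner \<Omega> f g"
  by (simp add: L2_inner_def mult.left_commute)

lemma L2_inner_commute: "L2_inner \<Omega> g f = cnj (L2_inner \<Omega> f g)"
proof -
  have "cnj (L2_inner \<Omega> f g) = (LINT x|lebesgue_on \<Omega>. cnj (cnj (f x) * g x))"
    unfolding L2_inner_def by (rule Bochner_Integration.integral_cnj[symmetric])
  also have "\<dots> = L2_inner \<Omega> g f"
    unfolding L2_inner_def by (intro Bochner_Integration.integral_cong refl) simp
  finally show ?thesis by simp
qed

lemma L2_inner_self: "L2_inner \<Omega> f f = complex_of_real ((L2_norm \<Omega> f)\<^sup>2)"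
proof -
  have "L2_inner \<Omega> f f = (LINT x|lebesgue_on \<Omega>. complex_of_real ((cmod (f x))\<^sup>2))"
    unfolding L2_inner_def by (intro Bochner_Integration.integral_cong refl) (metis complex_norm_square mult.commute)
  also have "\<dots> = complex_of_real (LINT x|lebesgue_on \<Omega>. (cmod (f x))\<^sup>2)"
    by (rule integral_complex_of_real)
  also have "(LINT x|lebesgue_on \<Omega>. (cmod (f x))\<^sup>2) = (L2_norm \<Omega> f)\<^sup>2"
    by (simp add: L2_norm_def)
  finally show ?thesis .
qed

lemma test_function_L2:
  assumes "open \<Omega>" "bounded \<Omega>" "\<phi> \<in> test_functions \<Omega>" "i \<in> Basis"
  shows "\<phi> \<in> L2 \<Omega>" "partial_deriv i \<phi> \<in> L2 \<Omega>"
proof -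
  have "C_on (Suc 0) UNIV \<phi>" using assms(3) unfolding test_functions_def smooth_on_def by blast
  then have "continuous_on UNIV (partial_deriv i \<phi>)" using assms(4) by simp
  moreover have "continuous_on UNIV \<phi>" using assms(3) by (rule test_function_continuous)
  ultimately show "\<phi> \<in> L2 \<Omega>" "partial_deriv i \<phi> \<in> L2 \<Omega>"
    using assms(1,2) by (auto intro!: continuous_on_closure_L2 intro: continuous_on_subset)
qed

lemma is_weak_partial_combine:
  assumes "open \<Omega>" "bounded \<Omega>" "i \<in> Basis"
    and "f \<in> L2 \<Omega>" "g \<in> L2 \<Omega>" "f' \<in> L2 \<Omega>" "g' \<in> L2 \<Omega>"
    and "is_weak_partial \<Omega> i f f'" "is_weak_partial \<Omega> i g g'"
  shows "is_weak_partial \<Omega> i (\<lambda>x. c * f x + g x) (\<lambda>x. c * f' x + g' x)"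
  unfolding is_weak_partial_def
proof
  fix \<phi> :: "'a \<Rightarrow> complex" assume \<phi>: "\<phi> \<in> test_functions \<Omega>"
  note L2 = test_function_L2[OF assms(1,2) \<phi> assms(3)]
  have split: "(LINT x|lebesgue_on \<Omega>. (c * u x + w x) * \<theta> x)
      = c * (LINT x|lebesgue_on \<Omega>. u x * \<theta> x) + (LINT x|lebesgue_on \<Omega>. w x * \<theta> x)"
    if "u \<in> L2 \<Omega>" "w \<in> L2 \<Omega>" "\<theta> \<in> L2 \<Omega>" for u w \<theta>
    using that by (simp add: distrib_right mult.assoc L2_mult_integrable)
  show "(LINT x|lebesgue_on \<Omega>. (c * f x + g x) * partial_deriv i \<phi> x)
      = - (LINT x|lebesgue_on \<Omega>. (c * f' x + g' x) * \<phi> x)"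
    using assms(8,9) \<phi> split[OF assms(4,5) L2(2)] split[OF assms(6,7) L2(1)]
    by (simp add: is_weak_partial_def algebra_simps)
qed

lemma is_weak_partial_unique:
  assumes "open \<Omega>" "bounded \<Omega>" "i \<in> Basis" "g \<in> L2 \<Omega>" "g' \<in> L2 \<Omega>"
    and "is_weak_partial \<Omega> i f g" "is_weak_partial \<Omega> i f g'"
  shows "AE x in lebesgue_on \<Omega>. g x = g' x"
proof -
  have diff: "(\<lambda>x. g x + (-1) * g' x) \<in> L2 \<Omega>" by (intro L2_add L2_scale assms)
  have one: "(\<lambda>x. 1) \<in> L2 \<Omega>"
    using assms(1,2) by (intro continuous_on_closure_L2) auto
  have "integrable (lebesgue_on \<Omega>) (\<lambda>x. g x + (-1) * g' x)"
    using L2_mult_integrable[OF diff one] by simp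
  moreover have "(LINT x|lebesgue_on \<Omega>. (g x + (-1) * g' x) * \<phi> x) = 0" if \<phi>: "\<phi> \<in> test_functions \<Omega>" for \<phi>
    using assms(6,7) \<phi> L2_mult_integrable[OF assms(4) test_function_L2(1)[OF assms(1,2) \<phi> assms(3)]]
      L2_mult_integrable[OF assms(5) test_function_L2(1)[OF assms(1,2) \<phi> assms(3)]]
    by (simp add: is_weak_partial_def left_diff_distrib)
  ultimately have "AE x in lebesgue_on \<Omega>. g x + (-1) * g' x = 0"
    by (rule fundamental_lemma_calculus_of_variations[OF assms(1)])
  then show ?thesis by eventually_elim simp
qed

lemma weak_partial_H1:
  assumes "f \<in> H1 \<Omega>" "i \<in> Basis"
  shows "weak_partial \<Omega> i f \<in> L2 \<Omega>" "is_weak_partial \<Omega> i f (weak_partial \<Omega> i f)"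
proof -
  have "\<exists>g. g \<in> L2 \<Omega> \<and> is_weak_partial \<Omega> i f g" using assms by (auto simp: H1_def)
  from someI_ex[OF this]
  show "weak_partial \<Omega> i f \<in> L2 \<Omega>" "is_weak_partial \<Omega> i f (weak_partial \<Omega> i f)"
    by (simp_all add: weak_partial_def)
qed

lemma H1_combine:
  assumes "open \<Omega>" "bounded \<Omega>" "f \<in> H1 \<Omega>" "g \<in> H1 \<Omega>"
  shows "(\<lambda>x. c * f x + g x) \<in> H1 \<Omega>"
  unfolding H1_def
proof (intro CollectI conjI ballI)
  have L2: "f \<in> L2 \<Omega>" "g \<in> L2 \<Omega>" using assms by (auto simp: H1_def)
  then show "(\<lambda>x. c * f x + g x) \<in> L2 \<Omega>" by (intro L2_add L2_scale)
  fix i :: 'a assume i: "i \<in> Basis"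
  show "\<exists>g'\<in>L2 \<Omega>. is_weak_partial \<Omega> i (\<lambda>x. c * f x + g x) g'"
    using is_weak_partial_combine[OF assms(1,2) i L2] weak_partial_H1[OF assms(3) i] weak_partial_H1[OF assms(4) i]
    by (intro bexI[of _ "\<lambda>x. c * weak_partial \<Omega> i f x + weak_partial \<Omega> i g x"] L2_add L2_scale) auto
qed

text \<open>\<open>weak_partial\<close> is a choice of representative and so not linear on the nose. It is linear almost
everywhere because weak derivatives are unique up to null sets, and the \<open>L2\<close> inner product does
not see null sets.\<close>

lemma grad_inner_combine:
  assumes "open \<Omega>" "bounded \<Omega>" "f \<in> H1 \<Omega>" "g \<in> H1 \<Omega>" "k \<in> H1 \<Omega>"
  shows "grad_inner \<Omega> k (\<lambda>x. c * f x + g x) = c * grad_inner \<Omega> k f + grad_inner \<Omega> k g"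
proof -
  have "L2_inner \<Omega> (weak_partial \<Omega> i k) (weak_partial \<Omega> i (\<lambda>x. c * f x + g x))
      = c * L2_inner \<Omega> (weak_partial \<Omega> i k) (weak_partial \<Omega> i f)
        + L2_inner \<Omega> (weak_partial \<Omega> i k) (weak_partial \<Omega> i g)" if i: "i \<in> Basis" for i
  proof -
    note wf = weak_partial_H1[OF assms(3) i] and wg = weak_partial_H1[OF assms(4) i]
      and wk = weak_partial_H1[OF assms(5) i]
    let ?w = "\<lambda>x. c * weak_partial \<Omega> i f x + weak_partial \<Omega> i g x"
    note wfg = weak_partial_H1[OF H1_combine[OF assms(1-4), of c] i]
    have fg: "f \<in> L2 \<Omega>" "g \<in> L2 \<Omega>" using assms by (auto simp: H1_def)
    have w_L2: "?w \<in> L2 \<Omega>" by (intro L2_add L2_scale wf wg)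
    have "AE x in lebesgue_on \<Omega>. weak_partial \<Omega> i (\<lambda>x. c * f x + g x) x = ?w x"
      by (rule is_weak_partial_unique[OF assms(1,2) i wfg(1) w_L2 wfg(2)])
        (rule is_weak_partial_combine[OF assms(1,2) i fg wf(1) wg(1) wf(2) wg(2)])
    then have "L2_inner \<Omega> (weak_partial \<Omega> i k) (weak_partial \<Omega> i (\<lambda>x. c * f x + g x))
        = L2_inner \<Omega> (weak_partial \<Omega> i k) ?w"
      unfolding L2_inner_def
      by (intro integral_cong_AE borel_measurable_integrable L2_mult_integrable L2_cnj wk wfg w_L2) auto
    also have "\<dots> = L2_inner \<Omega> (weak_partial \<Omega> i k) (\<lambda>x. c * weak_partial \<Omega> i f x)
        + L2_inner \<Omega> (weak_partial \<Omega> i k) (weak_partial \<Omega> i g)"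
      by (intro L2_inner_add L2_scale wk wf wg)
    finally show ?thesis by (simp add: L2_inner_scale)
  qed
  then show ?thesis
    by (simp add: grad_inner_def sum.distrib sum_distrib_left)
qed

lemma grad_inner_commute: "grad_inner \<Omega> g f = cnj (grad_inner \<Omega> f g)"
  by (simp add: grad_inner_def cnj_sum L2_inner_commute[of \<Omega> "weak_partial \<Omega> _ g"])

section \<open>The Hartree equation on a Galerkin space\<close>

lemma norm_integral_le_measure:
  fixes f :: "'a::euclidean_space \<Rightarrow> 'b::{banach, second_countable_topology}"
  assumes "\<Omega> \<in> lmeasurable" "0 \<le> M" "\<And>x. x \<in> \<Omega> \<Longrightarrow> norm (f x) \<le> M"
  shows "norm (LINT x|lebesgue_on \<Omega>. f x) \<le> M * measure lebesgue \<Omega>"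
proof (cases "integrable (lebesgue_on \<Omega>) f")
  case True
  have const: "integrable (lebesgue_on \<Omega>) (\<lambda>x. M)" by (rule finite_measure.integrable_const[OF finite_measure_lebesgue_on[OF assms(1)]])
  have "norm (LINT x|lebesgue_on \<Omega>. f x) \<le> (LINT x|lebesgue_on \<Omega>. norm (f x))"
    by (rule integral_norm_bound)
  also have "\<dots> \<le> (LINT x|lebesgue_on \<Omega>. M)"
    using True const assms(3) by (intro integral_mono) auto
  also have "\<dots> = M * measure lebesgue \<Omega>"
    using fmeasurableD[OF assms(1)] by (simp add: measure_restrict_space mult.commute)
  finally show ?thesis .
next
  case False
  then show ?thesis using assms(2) by (simp add: not_integrable_integral_eq)
qed

lemma test_function_bounded:
  assumes "f \<in> test_functions \<Omega>" shows "\<exists>M. \<forall>x. norm (f x) \<le> M"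
proof -
  have "compact (closure {x. f x \<noteq> 0})" using assms by (simp add: test_functions_def)
  then have "bounded (f ` closure {x. f x \<noteq> 0})"
    using test_function_continuous[OF assms]
    by (intro compact_imp_bounded compact_continuous_image) (auto intro: continuous_on_subset)
  then obtain M where M: "M > 0" "\<And>x. x \<in> closure {x. f x \<noteq> 0} \<Longrightarrow> norm (f x) \<le> M"
    by (auto simp: bounded_pos)
  have "norm (f x) \<le> M" for x
    using M closure_subset[of "{x. f x \<noteq> 0}"] by (cases "f x = 0") auto
  then show ?thesis by (intro exI allI)
qed

definition mass_density :: "('a \<Rightarrow> complex) \<Rightarrow> ('a \<Rightarrow> complex) \<Rightarrow> 'a \<Rightarrow> real" where
  "mass_density a b y = (cmod (b y))\<^sup>2 + (cmod (a y))\<^sup>2"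

definition hartree_potential ::
    "'a::euclidean_space set \<Rightarrow> ('a \<Rightarrow> real) \<Rightarrow> ('a \<Rightarrow> real) \<Rightarrow> ('a \<Rightarrow> complex) \<Rightarrow> ('a \<Rightarrow> complex) \<Rightarrow> 'a \<Rightarrow> real" where
  "hartree_potential \<Omega> lam V a b x = lam x / 2 * (LINT y|lebesgue_on \<Omega>. V (x - y) * mass_density a b y)"

text \<open>The nonlinear term acts as multiplication by a real-valued potential; this is what makes the
scheme conserve mass.\<close>

lemma hartree_g_mass_density:
  "1/2 * complex_of_real (lam x) *
     hartree_g \<Omega> V (\<lambda>y. complex_of_real ((cmod (b y))\<^sup>2 + (cmod (a y))\<^sup>2)) x
   = complex_of_real (hartree_potential \<Omega> lam V a b x)"
proof -
  have "hartree_g \<Omega> V (\<lambda>y. complex_of_real ((cmod (b y))\<^sup>2 + (cmod (a y))\<^sup>2)) x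
      = (LINT y|lebesgue_on \<Omega>. complex_of_real (V (x - y) * mass_density a b y))"
    by (simp add: hartree_g_def mass_density_def)
  then show ?thesis by (simp only: integral_complex_of_real) (simp add: hartree_potential_def)
qed

lemma L2_inner_real_potential:
  "L2_inner \<Omega> f (\<lambda>x. complex_of_real (p x) * f x) \<in> \<real>"
proof -
  have "L2_inner \<Omega> f (\<lambda>x. complex_of_real (p x) * f x)
      = (LINT x|lebesgue_on \<Omega>. complex_of_real (p x * (cmod (f x))\<^sup>2))"
    unfolding L2_inner_def of_real_mult complex_norm_square
    by (intro Bochner_Integration.integral_cong refl) (simp add: mult_ac)
  then show ?thesis by (simp only: integral_complex_of_real Reals_of_real)
qed

text \<open>Continuity of \<open>v\<close> and \<open>lam\<close> and \<open>V\<close> keeps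
all integrands continuous on the compact set \<open>closure \<Omega>\<close>, hence integrable.\<close>

locale hartree_galerkin =
  fixes \<Omega> :: "'a::euclidean_space set" and v lam V :: "'a \<Rightarrow> real"
    and B X :: "('a \<Rightarrow> complex) set"
  assumes open_\<Omega>: "open \<Omega>" and bounded_\<Omega>: "bounded \<Omega>"
    and cont: "continuous_on UNIV v" "continuous_on UNIV lam" "continuous_on UNIV V"
    and bound_lam: "\<exists>M. \<forall>x. \<bar>lam x\<bar> \<le> M" and bound_V: "\<exists>M. \<forall>x. \<bar>V x\<bar> \<le> M"
    and fin_B: "finite B" and span_X: "cfun.span B = X"
    and X_cont: "X \<subseteq> C_closure \<Omega>" and X_H1: "X \<subseteq> H1 \<Omega>"
begin

lemma lmeasurable_\<Omega>: "\<Omega> \<in> lmeasurable"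
  using open_\<Omega> bounded_\<Omega> by (simp add: lmeasurable_open)

lemma X_continuous: "f \<in> X \<Longrightarrow> continuous_on (closure \<Omega>) f"
  using X_cont by (auto simp: C_closure_def)

lemma cont_L2: "continuous_on (closure \<Omega>) f \<Longrightarrow> f \<in> L2 \<Omega>"
  by (rule continuous_on_closure_L2[OF open_\<Omega> bounded_\<Omega>])

lemma X_L2: "f \<in> X \<Longrightarrow> f \<in> L2 \<Omega>"
  by (intro cont_L2 X_continuous)

text \<open>Definiteness of the inner product on functions, not just on classes: an element of \<open>X\<close> that
vanishes almost everywhere in the open set \<open>\<Omega>\<close> vanishes in \<open>\<Omega>\<close> and on its closure by continuity,
and elsewhere by the normalisation built into \<open>C_closure\<close>.\<close>

lemma L2_norm_pos:
  assumes "f \<in> X" "f \<noteq> 0" shows "0 < (LINT x|lebesgue_on \<Omega>. (cmod (f x))\<^sup>2)"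
proof -
  have int: "integrable (lebesgue_on \<Omega>) (\<lambda>x. (cmod (f x))\<^sup>2)"
    using X_L2[OF assms(1)] by (simp add: L2_def)
  have "(LINT x|lebesgue_on \<Omega>. (cmod (f x))\<^sup>2) \<noteq> 0"
  proof
    assume "(LINT x|lebesgue_on \<Omega>. (cmod (f x))\<^sup>2) = 0"
    then have "AE x in lebesgue_on \<Omega>. (cmod (f x))\<^sup>2 = 0"
      using integral_nonneg_eq_0_iff_AE[OF int] by simp
    then have "AE x in lebesgue. x \<in> \<Omega> \<longrightarrow> f x = 0"
      using fmeasurableD[OF lmeasurable_\<Omega>] by (simp add: AE_restrict_space_iff)
    then have "AE x in lebesgue. x \<notin> \<Omega> \<inter> f -` (- {0})" by eventually_elim auto
    moreover have op: "open (\<Omega> \<inter> f -` (- {0}))"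
      using continuous_on_subset[OF X_continuous[OF assms(1)] closure_subset] open_\<Omega>
      by (intro continuous_open_preimage) auto
    ultimately have "negligible (\<Omega> \<inter> f -` (- {0}))"
      using AE_iff_null_sets[of "\<Omega> \<inter> f -` (- {0})" lebesgue]
      by (simp add: negligible_iff_null_sets borel_open)
    then have "\<Omega> \<inter> f -` (- {0}) = {}" using op open_not_negligible by blast
    then have "f x = 0" if "x \<in> closure \<Omega>" for x
      using continuous_constant_on_closure[OF X_continuous[OF assms(1)] _ that, of 0] by auto
    then have "f = 0" using assms(1) X_cont by (auto simp: fun_eq_iff C_closure_def)
    with assms(2) show False by simp
  qed
  moreover have "0 \<le> (LINT x|lebesgue_on \<Omega>. (cmod (f x))\<^sup>2)" by simp
  ultimately show ?thesis by linarith
qed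

sublocale finite_dim_inner_space "\<lambda>c f x. c * f x" B X "L2_inner \<Omega>"
proof unfold_locales
  show "finite B" "cfun.span B = X" by (fact fin_B span_X)+
  fix f g k assume "f \<in> X" "g \<in> X"
  then show "L2_inner \<Omega> f (\<lambda>x. c * g x) = c * L2_inner \<Omega> f g" for c by (rule_tac L2_inner_scale)
  show "L2_inner \<Omega> g f = cnj (L2_inner \<Omega> f g)" by (rule L2_inner_commute)
  assume "k \<in> X"
  with \<open>f \<in> X\<close> \<open>g \<in> X\<close> show "L2_inner \<Omega> f (g + k) = L2_inner \<Omega> f g + L2_inner \<Omega> f k"
    by (simp add: plus_fun_def L2_inner_add X_L2)
next
  fix f assume "f \<in> X" "f \<noteq> 0"
  then show "0 < Re (L2_inner \<Omega> f f)"
    using L2_norm_pos by (simp add: L2_inner_self L2_norm_def)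
qed

text \<open>The supremum norm is controlled by the \<open>L2\<close> norm: expand in the orthonormal basis, whose finitely
many elements are bounded. The nonlinearity can then be estimated pointwise.\<close>

lemma sup_bound:
  obtains C where "0 \<le> C" "\<And>f x. \<lbrakk>f \<in> X; x \<in> \<Omega>\<rbrakk> \<Longrightarrow> cmod (f x) \<le> C * nrm f"
proof -
  have "\<forall>e\<in>onb. \<exists>M. \<forall>x\<in>closure \<Omega>. cmod (e x) \<le> M"
  proof
    fix e assume "e \<in> onb"
    then have "bounded (e ` closure \<Omega>)"
      using bounded_\<Omega> X_continuous
      by (intro compact_imp_bounded compact_continuous_image) (auto simp: compact_closure)
    then show "\<exists>M. \<forall>x\<in>closure \<Omega>. cmod (e x) \<le> M" by (auto simp: bounded_iff)
  qed
  then obtain M where M: "\<And>e x. \<lbrakk>e \<in> onb; x \<in> closure \<Omega>\<rbrakk> \<Longrightarrow> cmod (e x) \<le> M e"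
    unfolding bchoice_iff by blast
  have "cmod (f x) \<le> (\<Sum>e\<in>onb. \<bar>M e\<bar>) * nrm f" if f: "f \<in> X" and x: "x \<in> \<Omega>" for f x
  proof -
    have eval: "(\<Sum>e\<in>F. (\<lambda>x. L2_inner \<Omega> e f * e x)) x = (\<Sum>e\<in>F. L2_inner \<Omega> e f * e x)"
      if "finite F" for F :: "('a \<Rightarrow> complex) set"
      using that by (induction F) auto
    have "f x = (\<Sum>e\<in>onb. L2_inner \<Omega> e f * e x)"
      using fun_cong[OF onb_expansion[OF f], of x] eval[OF onb(1)] by simp
    also have "cmod \<dots> \<le> (\<Sum>e\<in>onb. \<bar>M e\<bar> * nrm f)"
    proof (rule sum_norm_le)
      fix e assume e: "e \<in> onb"
      have "cmod (e x) \<le> \<bar>M e\<bar>" using M[OF e, of x] x closure_subset by force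
      then show "cmod (L2_inner \<Omega> e f * e x) \<le> \<bar>M e\<bar> * nrm f"
        using cmod_coeff_le[OF f e] by (simp add: norm_mult mult.commute mult_mono)
    qed
    finally show ?thesis by (simp add: sum_distrib_right)
  qed
  then show thesis by (intro that[of "\<Sum>e\<in>onb. \<bar>M e\<bar>"]) (auto intro: sum_nonneg)
qed

lemma mass_density_continuous: "\<lbrakk>a \<in> X; b \<in> X\<rbrakk> \<Longrightarrow> continuous_on (closure \<Omega>) (mass_density a b)"
  unfolding mass_density_def by (intro continuous_intros X_continuous)

lemma convolution_integrable:
  "\<lbrakk>a \<in> X; b \<in> X\<rbrakk> \<Longrightarrow> integrable (lebesgue_on \<Omega>) (\<lambda>y. V (x - y) * mass_density a b y)"
  by (intro continuous_on_closure_integrable[OF open_\<Omega> bounded_\<Omega>] continuous_intros mass_density_continuous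
      continuous_on_compose2[OF cont(3)]) auto

lemma hartree_potential_continuous:
  assumes "a \<in> X" "b \<in> X" shows "continuous_on S (hartree_potential \<Omega> lam V a b)"
proof -
  obtain M where M: "\<And>x. \<bar>V x\<bar> \<le> M" using bound_V by blast
  have "continuous_on UNIV (\<lambda>x. LINT y|lebesgue_on \<Omega>. V (x - y) * mass_density a b y)"
    unfolding continuous_on_sequentially
  proof (intro allI ballI impI, unfold comp_def)
    fix u x assume u: "(\<forall>n. u n \<in> UNIV) \<and> u \<longlonglongrightarrow> (x::'a)"
    show "(\<lambda>n. LINT y|lebesgue_on \<Omega>. V (u n - y) * mass_density a b y)
        \<longlonglongrightarrow> (LINT y|lebesgue_on \<Omega>. V (x - y) * mass_density a b y)"
    proof (rule integral_dominated_convergence[where w = "\<lambda>y. M * mass_density a b y"])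
      show "(\<lambda>y. V (x - y) * mass_density a b y) \<in> borel_measurable (lebesgue_on \<Omega>)"
        "(\<lambda>y. V (u n - y) * mass_density a b y) \<in> borel_measurable (lebesgue_on \<Omega>)" for n
        by (rule borel_measurable_integrable[OF convolution_integrable[OF assms]])+
      show "integrable (lebesgue_on \<Omega>) (\<lambda>y. M * mass_density a b y)"
        using mass_density_continuous[OF assms] continuous_on_closure_integrable[OF open_\<Omega> bounded_\<Omega>]
        by (intro integrable_mult_right) auto
      have "isCont V (x - y)" for y
        using cont(3) by (simp add: continuous_on_eq_continuous_at)
      then show "AE y in lebesgue_on \<Omega>. (\<lambda>n. V (u n - y) * mass_density a b y) \<longlonglongrightarrow> V (x - y) * mass_density a b y"
        using u by (intro AE_I2 tendsto_intros isCont_tendsto_compose[of "x - _" V]) auto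
      show "AE y in lebesgue_on \<Omega>. norm (V (u n - y) * mass_density a b y) \<le> M * mass_density a b y" for n
        using M by (intro AE_I2) (auto simp: abs_mult mass_density_def intro!: mult_right_mono)
    qed
  qed
  then have "continuous_on UNIV (\<lambda>x. lam x / 2 * (LINT y|lebesgue_on \<Omega>. V (x - y) * mass_density a b y))"
    by (intro continuous_on_mult continuous_on_divide continuous_on_const cont) auto
  then show ?thesis
    unfolding hartree_potential_def[abs_def] by (rule continuous_on_subset) simp
qed

definition average :: "('a \<Rightarrow> complex) \<Rightarrow> ('a \<Rightarrow> complex) \<Rightarrow> 'a \<Rightarrow> complex" where
  "average a b x = (b x + a x) / 2"

lemma average_eq: "average a b = (\<lambda>x. 1/2 * (b + a) x)"
  by (simp add: average_def fun_eq_iff)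

lemma average_in_X [simp]: "\<lbrakk>a \<in> X; b \<in> X\<rbrakk> \<Longrightarrow> average a b \<in> X"
  unfolding average_eq by (intro X_closed)

definition linear_form :: "('a \<Rightarrow> complex) \<Rightarrow> ('a \<Rightarrow> complex) \<Rightarrow> complex" where
  "linear_form \<phi> m = grad_inner \<Omega> \<phi> m + L2_inner \<Omega> \<phi> (\<lambda>x. complex_of_real (v x) * m x)"

definition hartree_form :: "('a \<Rightarrow> complex) \<Rightarrow> ('a \<Rightarrow> complex) \<Rightarrow> ('a \<Rightarrow> complex) \<Rightarrow> complex" where
  "hartree_form \<phi> a b =
     L2_inner \<Omega> \<phi> (\<lambda>x. complex_of_real (hartree_potential \<Omega> lam V a b x) * average a b x)"

lemma potential_L2:
  "\<lbrakk>continuous_on UNIV p; m \<in> X\<rbrakk> \<Longrightarrow> (\<lambda>x. complex_of_real (p x) * m x) \<in> L2 \<Omega>"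
  by (intro cont_L2 continuous_intros X_continuous) (auto intro: continuous_on_subset)

lemma L2_inner_combine:
  assumes "f \<in> L2 \<Omega>" "g \<in> L2 \<Omega>" "k \<in> L2 \<Omega>"
  shows "L2_inner \<Omega> f (\<lambda>x. c * g x + k x) = c * L2_inner \<Omega> f g + L2_inner \<Omega> f k"
  by (subst L2_inner_add) (auto simp: assms L2_scale L2_inner_scale)

lemma linear_form_combine:
  assumes "\<phi> \<in> X" "m \<in> X" "m' \<in> X"
  shows "linear_form \<phi> ((\<lambda>x. c * m x) + m') = c * linear_form \<phi> m + linear_form \<phi> m'"
proof -
  have "L2_inner \<Omega> \<phi> (\<lambda>x. c * (complex_of_real (v x) * m x) + complex_of_real (v x) * m' x)
      = c * L2_inner \<Omega> \<phi> (\<lambda>x. complex_of_real (v x) * m x) + L2_inner \<Omega> \<phi> (\<lambda>x. complex_of_real (v x) * m' x)"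
    using assms by (intro L2_inner_combine potential_L2 X_L2 cont)
  then show ?thesis
    using assms X_H1 grad_inner_combine[OF open_\<Omega> bounded_\<Omega>, of m m' \<phi> c]
    by (simp add: linear_form_def plus_fun_def algebra_simps subset_iff)
qed

lemma L2_inner_combine_left:
  assumes "f \<in> L2 \<Omega>" "g \<in> L2 \<Omega>" "k \<in> L2 \<Omega>"
  shows "L2_inner \<Omega> (\<lambda>x. c * g x + k x) f = cnj c * L2_inner \<Omega> g f + L2_inner \<Omega> k f"
  using L2_inner_combine[OF assms, of c] L2_inner_commute[of \<Omega> f] by (metis complex_cnj_add complex_cnj_mult complex_cnj_cnj)

lemma linear_form_combine_left:
  assumes "\<phi> \<in> X" "\<psi> \<in> X" "m \<in> X"
  shows "linear_form (\<lambda>x. c * \<phi> x + \<psi> x) m = cnj c * linear_form \<phi> m + linear_form \<psi> m"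
proof -
  have "grad_inner \<Omega> (\<lambda>x. c * \<phi> x + \<psi> x) m = cnj (c * grad_inner \<Omega> m \<phi> + grad_inner \<Omega> m \<psi>)"
    using assms X_H1 grad_inner_combine[OF open_\<Omega> bounded_\<Omega>, of \<phi> \<psi> m c]
      grad_inner_commute[of \<Omega> "\<lambda>x. c * \<phi> x + \<psi> x" m] by (auto simp: subset_iff)
  then have "grad_inner \<Omega> (\<lambda>x. c * \<phi> x + \<psi> x) m = cnj c * grad_inner \<Omega> \<phi> m + grad_inner \<Omega> \<psi> m"
    using grad_inner_commute[of \<Omega> \<phi> m] grad_inner_commute[of \<Omega> \<psi> m] by simp
  moreover have "L2_inner \<Omega> (\<lambda>x. c * \<phi> x + \<psi> x) (\<lambda>x. complex_of_real (v x) * m x)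
      = cnj c * L2_inner \<Omega> \<phi> (\<lambda>x. complex_of_real (v x) * m x) + L2_inner \<Omega> \<psi> (\<lambda>x. complex_of_real (v x) * m x)"
    using assms by (intro L2_inner_combine_left potential_L2 X_L2 cont)
  ultimately show ?thesis by (simp add: linear_form_def algebra_simps)
qed

lemma hartree_product_L2:
  "\<lbrakk>a \<in> X; b \<in> X\<rbrakk> \<Longrightarrow> (\<lambda>x. complex_of_real (hartree_potential \<Omega> lam V a b x) * average a b x) \<in> L2 \<Omega>"
  by (intro potential_L2 hartree_potential_continuous average_in_X)

lemma hartree_form_combine_left:
  "\<lbrakk>\<phi> \<in> X; \<psi> \<in> X; a \<in> X; b \<in> X\<rbrakk> \<Longrightarrow>
     hartree_form (\<lambda>x. c * \<phi> x + \<psi> x) a b = cnj c * hartree_form \<phi> a b + hartree_form \<psi> a b"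
  unfolding hartree_form_def by (intro L2_inner_combine_left hartree_product_L2 X_L2)

text \<open>On a ball in \<open>X\<close> all functions are pointwise bounded by a common \<open>M\<close>, and \<open>b - b'\<close> by a multiple
\<open>\<delta>\<close> of its norm. The potential is then bounded by a constant \<open>W\<close> and changes by at most
\<open>W' * \<delta>\<close>, the latter because \<open>|b|\<^sup>2 - |b'|\<^sup>2\<close> factors. The product with the midpoint
is treated by the usual splitting of a difference of products.\<close>

lemma hartree_form_Lipschitz:
  assumes "\<phi> \<in> X"
  shows "\<exists>K. \<forall>a\<in>X. \<forall>b\<in>X. \<forall>b'\<in>X. nrm a \<le> R \<longrightarrow> nrm b \<le> R \<longrightarrow> nrm b' \<le> R \<longrightarrow>
     cmod (hartree_form \<phi> a b - hartree_form \<phi> a b') \<le> K * nrm (b - b')"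
proof -
  obtain C where C: "0 \<le> C" "\<And>f x. \<lbrakk>f \<in> X; x \<in> \<Omega>\<rbrakk> \<Longrightarrow> cmod (f x) \<le> C * nrm f"
    using sup_bound by blast
  obtain K\<^sub>V where V: "\<And>x. \<bar>V x\<bar> \<le> K\<^sub>V" using bound_V by blast
  obtain K\<^sub>l where lam: "\<And>x. \<bar>lam x\<bar> \<le> K\<^sub>l" using bound_lam by blast
  have KV0: "0 \<le> K\<^sub>V" "0 \<le> K\<^sub>l" using V[of 0] lam[of 0] by linarith+
  define M where "M = C * \<bar>R\<bar>"
  define \<mu> where "\<mu> = measure lebesgue \<Omega>"
  have M0: "0 \<le> M" "0 \<le> \<mu>" using C by (simp_all add: M_def \<mu>_def)
  define W where "W = K\<^sub>l / 2 * (K\<^sub>V * (2 * M\<^sup>2) * \<mu>)"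
  define W' where "W' = K\<^sub>l / 2 * (K\<^sub>V * (2 * M) * \<mu>)"
  have W0: "0 \<le> W" "0 \<le> W'" using M0 KV0 by (simp_all add: W_def W'_def)
  have "cmod (hartree_form \<phi> a b - hartree_form \<phi> a b')
      \<le> (C * nrm \<phi> * (W' * M + W) * C * \<mu>) * nrm (b - b')"
    if ab: "a \<in> X" "b \<in> X" "b' \<in> X" "nrm a \<le> R" "nrm b \<le> R" "nrm b' \<le> R" for a b b'
  proof -
    have sup: "cmod (f x) \<le> M" if "f \<in> X" "nrm f \<le> R" "x \<in> \<Omega>" for f x
    proof -
      have "cmod (f x) \<le> C * nrm f" using that by (intro C)
      also have "\<dots> \<le> M" using that C unfolding M_def by (intro mult_left_mono) auto
      finally show ?thesis .
    qed
    define \<delta> where "\<delta> = C * nrm (b - b')"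
    have \<delta>: "cmod (b x - b' x) \<le> \<delta>" if "x \<in> \<Omega>" for x
      using C(2)[of "b - b'" x] that ab by (simp add: \<delta>_def)
    have \<delta>0: "0 \<le> \<delta>" using C ab by (simp add: \<delta>_def)
    let ?p = "hartree_potential \<Omega> lam V a b" and ?p' = "hartree_potential \<Omega> lam V a b'"
    have p': "\<bar>?p' x\<bar> \<le> W" for x
    proof -
      have "norm (LINT y|lebesgue_on \<Omega>. V (x - y) * mass_density a b' y) \<le> K\<^sub>V * (2 * M\<^sup>2) * \<mu>"
        unfolding \<mu>_def
      proof (rule norm_integral_le_measure[OF lmeasurable_\<Omega>])
        fix y assume y: "y \<in> \<Omega>"
        have "(cmod (b' y))\<^sup>2 \<le> M\<^sup>2" "(cmod (a y))\<^sup>2 \<le> M\<^sup>2"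
          using sup y ab by (auto intro!: power_mono)
        then have "\<bar>mass_density a b' y\<bar> \<le> 2 * M\<^sup>2" by (simp add: mass_density_def)
        then show "norm (V (x - y) * mass_density a b' y) \<le> K\<^sub>V * (2 * M\<^sup>2)"
          using V[of "x - y"] KV0 by (auto simp: abs_mult intro!: mult_mono)
      qed (use KV0 M0 in simp)
      then have "\<bar>lam x / 2\<bar> * \<bar>LINT y|lebesgue_on \<Omega>. V (x - y) * mass_density a b' y\<bar> \<le> W"
        using lam[of x] KV0 unfolding W_def by (intro mult_mono) auto
      then show ?thesis by (simp only: hartree_potential_def abs_mult)
    qed
    have pp': "\<bar>?p x - ?p' x\<bar> \<le> W' * \<delta>" for x
    proof -
      have "norm (LINT y|lebesgue_on \<Omega>. V (x - y) * mass_density a b y - V (x - y) * mass_density a b' y)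
          \<le> K\<^sub>V * (2 * M * \<delta>) * \<mu>"
        unfolding \<mu>_def
      proof (rule norm_integral_le_measure[OF lmeasurable_\<Omega>])
        fix y assume y: "y \<in> \<Omega>"
        have "\<bar>(cmod (b y))\<^sup>2 - (cmod (b' y))\<^sup>2\<bar> = (cmod (b y) + cmod (b' y)) * \<bar>cmod (b y) - cmod (b' y)\<bar>"
          by (simp add: square_diff_square_factored abs_mult power2_eq_square)
        also have "\<dots> \<le> (2 * M) * \<delta>"
          using sup[of b y] sup[of b' y] y ab \<delta>[OF y] norm_triangle_ineq3[of "b y" "b' y"] M0
          by (intro mult_mono) auto
        finally have "\<bar>mass_density a b y - mass_density a b' y\<bar> \<le> 2 * M * \<delta>" by (simp add: mass_density_def)
        then show "norm (V (x - y) * mass_density a b y - V (x - y) * mass_density a b' y) \<le> K\<^sub>V * (2 * M * \<delta>)"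
          using V[of "x - y"] KV0 by (auto simp: abs_mult simp flip: right_diff_distrib intro!: mult_mono)
      qed (use KV0 M0 \<delta>0 in simp)
      then have "\<bar>lam x / 2\<bar> * \<bar>LINT y|lebesgue_on \<Omega>. V (x - y) * mass_density a b y - V (x - y) * mass_density a b' y\<bar>
          \<le> K\<^sub>l / 2 * (K\<^sub>V * (2 * M * \<delta>) * \<mu>)"
        using lam[of x] KV0 by (intro mult_mono) auto
      moreover have "?p x - ?p' x
          = lam x / 2 * (LINT y|lebesgue_on \<Omega>. V (x - y) * mass_density a b y - V (x - y) * mass_density a b' y)"
        using ab by (simp add: hartree_potential_def convolution_integrable right_diff_distrib)
      moreover have "W' * \<delta> = K\<^sub>l / 2 * (K\<^sub>V * (2 * M * \<delta>) * \<mu>)" by (simp add: W'_def)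
      ultimately show ?thesis by (simp only: abs_mult)
    qed
    have "hartree_form \<phi> a b - hartree_form \<phi> a b'
        = (LINT x|lebesgue_on \<Omega>. cnj (\<phi> x) * (complex_of_real (?p x) * average a b x)
            - cnj (\<phi> x) * (complex_of_real (?p' x) * average a b' x))"
      unfolding hartree_form_def L2_inner_def
      using assms ab
      by (intro Bochner_Integration.integral_diff[symmetric] L2_mult_integrable L2_cnj hartree_product_L2 X_L2)
    also have "cmod \<dots> \<le> (C * nrm \<phi> * (W' * \<delta> * M + W * \<delta>)) * \<mu>"
      unfolding \<mu>_def
    proof (rule norm_integral_le_measure[OF lmeasurable_\<Omega>])
      fix x assume x: "x \<in> \<Omega>"
      have m: "cmod (average a b x) \<le> M"
        using norm_triangle_ineq[of "b x" "a x"] sup[of a x] sup[of b x] x ab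
        by (simp add: average_def norm_divide)
      have mm: "cmod (average a b x - average a b' x) \<le> \<delta>"
      proof -
        have "average a b x - average a b' x = (b x - b' x) / 2"
          by (simp add: average_def diff_divide_distrib add_divide_distrib)
        moreover have "cmod ((b x - b' x) / 2) \<le> \<delta>"
          using \<delta>[OF x] \<delta>0 unfolding norm_divide by simp
        ultimately show ?thesis by (simp only:)
      qed
      have split: "complex_of_real (?p x) * average a b x - complex_of_real (?p' x) * average a b' x
          = complex_of_real (?p x - ?p' x) * average a b x
            + complex_of_real (?p' x) * (average a b x - average a b' x)"
        by (simp add: algebra_simps)
      have "cmod (complex_of_real (?p x) * average a b x - complex_of_real (?p' x) * average a b' x)
          \<le> cmod (complex_of_real (?p x - ?p' x)) * cmod (average a b x)
            + cmod (complex_of_real (?p' x)) * cmod (average a b x - average a b' x)"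
        unfolding split norm_mult[symmetric] by (rule norm_triangle_ineq)
      also have "\<dots> \<le> W' * \<delta> * M + W * \<delta>"
        unfolding norm_of_real
        by (intro add_mono mult_mono pp' p' m mm W0 mult_nonneg_nonneg \<delta>0 norm_ge_zero)
      finally have "cmod (\<phi> x) * cmod (complex_of_real (?p x) * average a b x
            - complex_of_real (?p' x) * average a b' x) \<le> C * nrm \<phi> * (W' * \<delta> * M + W * \<delta>)"
        using C(2)[OF assms x] C(1) assms by (intro mult_mono) auto
      then show "norm (cnj (\<phi> x) * (complex_of_real (?p x) * average a b x)
            - cnj (\<phi> x) * (complex_of_real (?p' x) * average a b' x)) \<le> C * nrm \<phi> * (W' * \<delta> * M + W * \<delta>)"
        by (simp add: norm_mult flip: right_diff_distrib)
    qed (use C assms W0 M0 \<delta>0 in simp)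
    finally show ?thesis by (simp add: \<delta>_def algebra_simps)
  qed
  then show ?thesis by blast
qed

definition scheme_form :: "('a \<Rightarrow> complex) \<Rightarrow> ('a \<Rightarrow> complex) \<Rightarrow> ('a \<Rightarrow> complex) \<Rightarrow> complex" where
  "scheme_form \<phi> a b = linear_form \<phi> (average a b) + hartree_form \<phi> a b"

sublocale conservative_scheme "\<lambda>c f x. c * f x" B X "L2_inner \<Omega>" scheme_form
proof unfold_locales
  fix \<phi> \<psi> a b assume X: "\<phi> \<in> X" "a \<in> X" "b \<in> X"
  have comb: "scheme_form (\<lambda>x. c * \<phi> x + \<psi> x) a b = cnj c * scheme_form \<phi> a b + scheme_form \<psi> a b" if "\<psi> \<in> X" for c \<psi>
    unfolding scheme_form_def linear_form_combine_left[OF X(1) that average_in_X[OF X(2,3)]]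
      hartree_form_combine_left[OF X(1) that X(2,3)]
    by (simp add: distrib_left)
  have zero: "scheme_form (\<lambda>x. 0) a b = 0"
    using comb[of "\<lambda>x. 0" 0] comb[of "\<lambda>x. 0" 1] X_closed(1) by (simp add: zero_fun_def)
  show "scheme_form (\<lambda>x. c * \<phi> x) a b = cnj c * scheme_form \<phi> a b" for c
    using comb[of "\<lambda>x. 0" c] X_closed(1) zero by (simp add: zero_fun_def)
  show "scheme_form (\<phi> + \<psi>) a b = scheme_form \<phi> a b + scheme_form \<psi> a b" if "\<psi> \<in> X"
    using comb[OF that, of 1] by (simp add: plus_fun_def)
next
  fix \<phi> a assume X: "\<phi> \<in> X" "a \<in> X"
  have "average a (- a) = (\<lambda>x. 0)" by (simp add: average_def fun_eq_iff)
  moreover have "linear_form \<phi> 0 = 0"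
  proof -
    have "(\<lambda>x. 1 * (0 :: 'a \<Rightarrow> complex) x) + 0 = 0" by (simp add: fun_eq_iff)
    then show ?thesis
      using linear_form_combine[OF X(1) X_closed(1) X_closed(1), of 1] by simp
  qed
  ultimately show "scheme_form \<phi> a (- a) = 0"
    by (simp add: scheme_form_def hartree_form_def zero_fun_def L2_inner_def)
next
  fix \<phi> R assume \<phi>: "\<phi> \<in> X"
  obtain K where K: "\<And>m. m \<in> X \<Longrightarrow> cmod (linear_form \<phi> m) \<le> K * nrm m"
    using linear_functional_bounded[of "linear_form \<phi>"] linear_form_combine[OF \<phi>] by blast
  obtain K' where K': "\<And>a b b'. \<lbrakk>a \<in> X; b \<in> X; b' \<in> X; nrm a \<le> R; nrm b \<le> R; nrm b' \<le> R\<rbrakk> \<Longrightarrow>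
     cmod (hartree_form \<phi> a b - hartree_form \<phi> a b') \<le> K' * nrm (b - b')"
    using hartree_form_Lipschitz[OF \<phi>, of R] by blast
  have "cmod (scheme_form \<phi> a b - scheme_form \<phi> a b') \<le> (K / 2 + K') * nrm (b - b')"
    if ab: "a \<in> X" "b \<in> X" "b' \<in> X" "nrm a \<le> R" "nrm b \<le> R" "nrm b' \<le> R" for a b b'
  proof -
    have "average a b = (\<lambda>x. (1/2) * (b - b') x) + average a b'"
      by (simp add: average_def fun_eq_iff field_simps)
    then have "linear_form \<phi> (average a b) = 1/2 * linear_form \<phi> (b - b') + linear_form \<phi> (average a b')"
      using linear_form_combine[OF \<phi>, of "b - b'" "average a b'" "1/2"] ab by simp
    then have "scheme_form \<phi> a b - scheme_form \<phi> a b' = 1/2 * linear_form \<phi> (b - b') + (hartree_form \<phi> a b - hartree_form \<phi> a b')"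
      by (simp add: scheme_form_def)
    also have "cmod \<dots> \<le> cmod (1/2 * linear_form \<phi> (b - b')) + cmod (hartree_form \<phi> a b - hartree_form \<phi> a b')"
      by (rule norm_triangle_ineq)
    also have "\<dots> \<le> K / 2 * nrm (b - b') + K' * nrm (b - b')"
      using K[of "b - b'"] K'[OF ab] ab by (intro add_mono) (auto simp: norm_mult)
    finally show ?thesis by (simp add: algebra_simps)
  qed
  then show "\<exists>K. \<forall>a\<in>X. \<forall>b\<in>X. \<forall>b'\<in>X. nrm a \<le> R \<longrightarrow> nrm b \<le> R \<longrightarrow> nrm b' \<le> R \<longrightarrow>
      cmod (scheme_form \<phi> a b - scheme_form \<phi> a b') \<le> K * nrm (b - b')" by blast
next
  fix a b assume "a \<in> X" "b \<in> X"
  have "grad_inner \<Omega> m m \<in> \<real>" for m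
    using grad_inner_commute[of \<Omega> m m] by (simp add: Reals_cnj_iff)
  then show "scheme_form (\<lambda>x. 1/2 * (b + a) x) a b \<in> \<real>"
    unfolding scheme_form_def linear_form_def hartree_form_def average_eq[symmetric]
    by (intro Reals_add L2_inner_real_potential)
qed

lemma step_eq:
  "step \<tau> a b \<longleftrightarrow> b \<in> X \<and> (\<forall>\<phi>\<in>X. \<i> * L2_inner \<Omega> \<phi> (\<lambda>x. (b x - a x) / complex_of_real \<tau>) =
     grad_inner \<Omega> \<phi> (average a b) + L2_inner \<Omega> \<phi> (\<lambda>x. complex_of_real (v x) * average a b x)
     + L2_inner \<Omega> \<phi> (\<lambda>x. 1/2 * complex_of_real (lam x)
         * hartree_g \<Omega> V (\<lambda>y. complex_of_real ((cmod (b y))\<^sup>2 + (cmod (a y))\<^sup>2)) x * average a b x))"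
proof -
  have "(\<lambda>x. 1 / complex_of_real \<tau> * (b - a) x) = (\<lambda>x. (b x - a x) / complex_of_real \<tau>)"
    by (simp add: fun_eq_iff)
  then show ?thesis
    unfolding step_def scheme_form_def linear_form_def hartree_form_def hartree_g_mass_density by simp
qed

lemma incoherent_solution_iff:
  assumes "\<psi>\<^sub>0 \<in> X"
  shows "incoherent_solution \<Omega> v lam V X T N \<psi>\<^sub>0 \<Psi> \<longleftrightarrow>
     \<Psi> \<in> {0..N} \<rightarrow>\<^sub>E X \<and> \<Psi> 0 = \<psi>\<^sub>0 \<and> (\<forall>n\<in>{1..N}. step (T / real N) (\<Psi> (n - 1)) (\<Psi> n))"
proof -
  have "midpt \<Psi> n = average (\<Psi> (n - 1)) (\<Psi> n)" for n
    by (simp add: midpt_def average_def fun_eq_iff)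
  moreover have "time_diff \<tau> \<Psi> n = (\<lambda>x. (\<Psi> n x - \<Psi> (n - 1) x) / complex_of_real \<tau>)" for n \<tau>
    by (simp add: time_diff_def fun_eq_iff)
  ultimately show ?thesis
    unfolding incoherent_solution_def step_eq by (auto simp: PiE_def Pi_def)
qed

text \<open>The spheres of \<open>X\<close> are preserved by the step, so the threshold for the initial norm serves at
every time level.\<close>

lemma unique_incoherent_solution:
  assumes "\<psi>\<^sub>0 \<in> X" "0 < T"
  shows "\<exists>\<tau>\<^sub>0>0. \<forall>N\<ge>1. T / real N \<le> \<tau>\<^sub>0 \<longrightarrow> (\<exists>!\<Psi>. incoherent_solution \<Omega> v lam V X T N \<psi>\<^sub>0 \<Psi>)"
proof -
  obtain \<tau>\<^sub>0 where \<tau>\<^sub>0: "\<tau>\<^sub>0 > 0"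
    "\<And>\<tau> a. \<lbrakk>0 < \<tau>; \<tau> \<le> \<tau>\<^sub>0; a \<in> X; nrm a = nrm \<psi>\<^sub>0\<rbrakk> \<Longrightarrow> \<exists>!b. step \<tau> a b"
    using step_uniquely_solvable[of "nrm \<psi>\<^sub>0"] by blast
  show ?thesis
  proof (intro exI[of _ \<tau>\<^sub>0] conjI allI impI)
    fix N :: nat assume N: "1 \<le> N" "T / real N \<le> \<tau>\<^sub>0"
    have \<tau>: "0 < T / real N" using N assms by simp
    show "\<exists>!\<Psi>. incoherent_solution \<Omega> v lam V X T N \<psi>\<^sub>0 \<Psi>"
      unfolding incoherent_solution_iff[OF assms(1)]
    proof (rule unique_iteration[where Q = "{a \<in> X. nrm a = nrm \<psi>\<^sub>0}"])
      show "\<exists>!b. step (T / real N) a b" if "a \<in> {a \<in> X. nrm a = nrm \<psi>\<^sub>0}" for a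
        using \<tau>\<^sub>0(2)[OF \<tau> N(2)] that by simp
      show "b \<in> {a \<in> X. nrm a = nrm \<psi>\<^sub>0}"
        if "a \<in> {a \<in> X. nrm a = nrm \<psi>\<^sub>0}" "step (T / real N) a b" for a b
        using step_conserves_nrm[OF _ that(2) \<tau>] that by (auto simp: step_def)
    qed (use assms in auto)
  qed (rule \<tau>\<^sub>0)
qed

end

theorem theorem36:
  fixes \<Omega> :: "'a::euclidean_space set"
    and v lam V :: "'a \<Rightarrow> real"
    and S :: "real \<Rightarrow> ('a \<Rightarrow> complex) set"
    and dims :: "real \<Rightarrow> nat"
    and C\<^sub>B T h :: real
    and \<psi>\<^sub>0 :: "'a \<Rightarrow> complex"
  assumes "bounded_smooth_domain \<Omega>"
    and "v \<in> test_functions \<Omega>"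
    and "lam \<in> test_functions \<Omega>"
    and "V \<in> test_functions UNIV"
    and "galerkin_family \<Omega> S dims"
    and "C\<^sub>B > 0"
    and "\<And>h \<phi>. h \<in> {0<..<1} \<Longrightarrow> \<phi> \<in> S h \<Longrightarrow> H1_norm \<Omega> \<phi> \<le> C\<^sub>B * inverse h * L2_norm \<Omega> \<phi>"
    and "0 < T"
    and "h \<in> {0<..<1}"
    and "\<psi>\<^sub>0 \<in> S h"
  shows "\<exists>\<tau>\<^sub>0>0. \<forall>N\<ge>1. T / real N \<le> \<tau>\<^sub>0 \<longrightarrow>
           (\<exists>!\<Psi>. incoherent_solution \<Omega> v lam V (S h) T N \<psi>\<^sub>0 \<Psi>)"
proof -
  have S: "S h \<subseteq> C_closure \<Omega>" "S h \<subseteq> H1 \<Omega>" "has_dim (S h) (dims h)"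
    using assms(5,9) by (auto simp: galerkin_family_def H10_def)
  obtain B where B: "finite B" "cfun.span B = S h"
    using S(3) by (auto simp: has_dim_def)
  interpret hartree_galerkin \<Omega> v lam V B "S h"
  proof
    show "\<exists>M. \<forall>x. \<bar>lam x\<bar> \<le> M" using test_function_bounded[OF assms(3)] by simp
    show "\<exists>M. \<forall>x. \<bar>V x\<bar> \<le> M" using test_function_bounded[OF assms(4)] by simp
  qed (use assms(1) S B in \<open>auto simp: bounded_smooth_domain_def
      intro: test_function_continuous[OF assms(2)] test_function_continuous[OF assms(3)] test_function_continuous[OF assms(4)]\<close>)
  show ?thesis by (rule unique_incoherent_solution[OF assms(10,8)])
qed

end
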